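(* Every modularly extended simple matroid has a divisional flag. In particular, if $\mathcal{A}$ is a central hyperplane arrangement whose linear dependence matroid $M(\mathcal{A})$ is modularly extended, then $\mathcal{A}$ is divisionally free.
   Context: All matroids are finite. For a simple matroid $M$ on ground set $E$ with rank function $r$, flats are ordered by inclusion and form the geometric lattice $L(M)$; the join of flats $X,Y$ is $X\vee Y=\mathrm{cl}(X\cup Y)$. Elements of $E$ are called atoms; a coatom is a flat of rank $r(E)-1$. A flat $X$ is modular if $r(X)+r(Y)=r(X\cap Y)+r(X\vee Y)$ for every flat $Y$. $M|X$ is the restriction, $M/X$ the contraction (whose lattice of flats is the interval $\{F\in L(M): X\subseteq F\}$), and $\mathrm{si}(N)$ the simplification of a matroid $N$. The characteristic polynomial is $\chi(M,t)=\sum_{X\in L(M)}\mu(X)t^{r(E)-r(X)}$, where $\mu(\varnothing)=1$ and $\mu(X)=-\sum_{Y\subsetneq X,\,Y\in L(M)}\mu(Y)$; for a contraction it is computed from its lattice of flats, so $\chi(M/X,t)=\chi(\mathrm{si}(M/X),t)$. A simple matroid $M$ is a modular join if $E=E_1\cup E_2$ for two proper modular flats $E_1,E_2$; then one writes $M=P_X(E_1,E_2)=P_X(M|E_1,M|E_2)$ with $X=E_1\cap E_2$ ("modular join over $X$"). A matroid is round if its ground set is not the union of two proper flats; a flat $S$ is round if $M|S$ is round. The class $\mathcal{ME}$ of modularly extended matroids is the smallest class of simple matroids such that: (i) the empty matroid is in $\mathcal{ME}$; (ii) if a simple matroid $M$ has a modular coatom $X$ with $M|X\in\mathcal{ME}$,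 then $M\in\mathcal{ME}$; (iii) if $M$ is a modular join $P_X(M_1,M_2)$ over a round flat $X$ with $M_1,M_2\in\mathcal{ME}$, then $M\in\mathcal{ME}$. A divisional flag of a simple matroid $M$ of rank $n$ is a chain of flats $\varnothing=X_0\subseteq X_1\subseteq\dots\subseteq X_n=E$ with $r(X_i)=i$ for all $i$ and $\chi(M/X_{i+1},t)$ dividing $\chi(M/X_i,t)$ for $i=0,\dots,n-1$. A central hyperplane arrangement $\mathcal{A}$ is a finite set of linear hyperplanes in $\mathbb{K}^\ell$ ($\mathbb{K}$ a field); its linear dependence matroid $M(\mathcal{A})$ is the simple matroid on $\mathcal{A}$ in which $\{H_1,\dots,H_k\}$ is independent iff $H_1\cap\dots\cap H_k$ has codimension $k$. $\mathcal{A}$ is divisionally free if $M(\mathcal{A})$ has a divisional flag. *)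

theory Defs
  imports "HOL-Analysis.Analysis" "HOL-Computational_Algebra.Polynomial"
begin

datatype 'a matroid = Matroid (ground: "'a set") (indep: "'a set \<Rightarrow> bool")

definition is_matroid :: "'a matroid \<Rightarrow> bool" where
  "is_matroid M \<longleftrightarrow>
     finite (ground M) \<and>
     (\<forall>A. indep M A \<longrightarrow> A \<subseteq> ground M) \<and>
     indep M {} \<and>
     (\<forall>A B. indep M B \<and> A \<subseteq> B \<longrightarrow> indep M A) \<and>
     (\<forall>A B. indep M A \<and> indep M B \<and> card A < card B \<longrightarrow> (\<exists>x\<in>B - A. indep M (insert x A)))"

text \<open>No loops (the case \<open>e = f\<close>) and no two parallel elements.\<close>

definition simple_matroid :: "'a matroid \<Rightarrow> bool" where
  "simple_matroid M \<longleftrightarrow> is_matroid M \<and> (\<forall>e\<in>ground M. \<forall>f\<in>ground M. indep M {e, f})"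

definition rk :: "'a matroid \<Rightarrow> 'a set \<Rightarrow> nat" where
  "rk M A = Max (card ` {B. B \<subseteq> A \<and> indep M B})"

definition cl :: "'a matroid \<Rightarrow> 'a set \<Rightarrow> 'a set" where
  "cl M A = {e \<in> ground M. rk M (insert e A) = rk M A}"

definition flat :: "'a matroid \<Rightarrow> 'a set \<Rightarrow> bool" where
  "flat M F \<longleftrightarrow> F \<subseteq> ground M \<and> cl M F = F"

definition flat_join :: "'a matroid \<Rightarrow> 'a set \<Rightarrow> 'a set \<Rightarrow> 'a set" where
  "flat_join M X Y = cl M (X \<union> Y)"

definition coatom :: "'a matroid \<Rightarrow> 'a set \<Rightarrow> bool" where
  "coatom M X \<longleftrightarrow> flat M X \<and> rk M X + 1 = rk M (ground M)"

definition modular_flat :: "'a matroid \<Rightarrow> 'a set \<Rightarrow> bool" where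
  "modular_flat M X \<longleftrightarrow> flat M X \<and>
     (\<forall>Y. flat M Y \<longrightarrow> rk M X + rk M Y = rk M (X \<inter> Y) + rk M (flat_join M X Y))"

definition restriction :: "'a matroid \<Rightarrow> 'a set \<Rightarrow> 'a matroid" where
  "restriction M X = Matroid X (\<lambda>A. A \<subseteq> X \<and> indep M A)"

text \<open>The rank function of the contraction \<open>M/X\<close> is \<open>A \<mapsto> rk M (A \<union> X) - rk M X\<close>; its
  independent sets are the sets whose rank in \<open>M/X\<close> equals their cardinality. The ground set is
  not simplified: a flat \<open>F \<supseteq> X\<close> of \<open>M\<close> corresponds to the flat \<open>F - X\<close> of \<open>M/X\<close>.\<close>

definition contraction :: "'a matroid \<Rightarrow> 'a set \<Rightarrow> 'a matroid" where
  "contraction M X =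
     Matroid (ground M - X) (\<lambda>A. A \<subseteq> ground M - X \<and> rk M (A \<union> X) = card A + rk M X)"

text \<open>The Moebius function \<open>\<mu>(0, X)\<close> of the lattice of flats. Its bottom element is the closure
  of the empty set, which is empty for a simple matroid and for a contraction of a matroid by a
  flat. Finiteness of \<open>X\<close> is only needed for termination. The value is meaningful only if \<open>X\<close> is
  a flat.\<close>

function moebius :: "'a matroid \<Rightarrow> 'a set \<Rightarrow> int" where
  "moebius M X =
     (if finite X \<and> X \<noteq> cl M {} then - (\<Sum>Y | flat M Y \<and> Y \<subset> X. moebius M Y) else 1)"
  by pat_completeness auto
termination
  by (relation "Wellfounded.measure (\<lambda>(M, X). card X)") (auto intro: psubset_card_mono)

declare moebius.simps [simp del]

definition characteristic_polynomial :: "'a matroid \<Rightarrow> int poly" where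
  "characteristic_polynomial M =
     (\<Sum>X | flat M X. monom (moebius M X) (rk M (ground M) - rk M X))"

definition round_matroid :: "'a matroid \<Rightarrow> bool" where
  "round_matroid M \<longleftrightarrow>
     \<not> (\<exists>F G. flat M F \<and> flat M G \<and> F \<noteq> ground M \<and> G \<noteq> ground M \<and> F \<union> G = ground M)"

definition round_flat :: "'a matroid \<Rightarrow> 'a set \<Rightarrow> bool" where
  "round_flat M S \<longleftrightarrow> flat M S \<and> round_matroid (restriction M S)"

text \<open>\<open>M\<close> is the modular join \<open>P\<^sub>X(M|E\<^sub>1, M|E\<^sub>2)\<close> with \<open>X = E\<^sub>1 \<inter> E\<^sub>2\<close>.\<close>

definition modular_join :: "'a matroid \<Rightarrow> 'a set \<Rightarrow> 'a set \<Rightarrow> bool" where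
  "modular_join M E\<^sub>1 E\<^sub>2 \<longleftrightarrow>
     ground M = E\<^sub>1 \<union> E\<^sub>2 \<and>
     modular_flat M E\<^sub>1 \<and> E\<^sub>1 \<noteq> ground M \<and>
     modular_flat M E\<^sub>2 \<and> E\<^sub>2 \<noteq> ground M"

inductive modularly_extended :: "'a matroid \<Rightarrow> bool" where
  empty: "simple_matroid M \<Longrightarrow> ground M = {} \<Longrightarrow> modularly_extended M"
| coatom: "simple_matroid M \<Longrightarrow> coatom M X \<Longrightarrow> modular_flat M X \<Longrightarrow>
    modularly_extended (restriction M X) \<Longrightarrow> modularly_extended M"
| join: "simple_matroid M \<Longrightarrow> modular_join M E\<^sub>1 E\<^sub>2 \<Longrightarrow> round_flat M (E\<^sub>1 \<inter> E\<^sub>2) \<Longrightarrow>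
    modularly_extended (restriction M E\<^sub>1) \<Longrightarrow> modularly_extended (restriction M E\<^sub>2) \<Longrightarrow>
    modularly_extended M"

text \<open>Only the values \<open>X 0, \<dots>, X n\<close> with \<open>n = rk M (ground M)\<close> matter.\<close>

definition divisional_flag :: "'a matroid \<Rightarrow> (nat \<Rightarrow> 'a set) \<Rightarrow> bool" where
  "divisional_flag M X \<longleftrightarrow>
     (let n = rk M (ground M) in
       X 0 = {} \<and> X n = ground M \<and>
       (\<forall>i\<le>n. flat M (X i) \<and> rk M (X i) = i) \<and>
       (\<forall>i<n. X i \<subseteq> X (Suc i) \<and>
          characteristic_polynomial (contraction M (X (Suc i)))
            dvd characteristic_polynomial (contraction M (X i))))"

definition has_divisional_flag :: "'a matroid \<Rightarrow> bool" where
  "has_divisional_flag M \<longleftrightarrow> (\<exists>X. divisional_flag M X)"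

definition codimension :: "('k::field ^ 'n) set \<Rightarrow> nat" where
  "codimension S = CARD('n) - vec.dim S"

definition central_arrangement :: "('k::field ^ 'n) set set \<Rightarrow> bool" where
  "central_arrangement \<A> \<longleftrightarrow>
     finite \<A> \<and> (\<forall>H\<in>\<A>. vec.subspace H \<and> codimension H = 1)"

text \<open>The intersection of the empty family is the whole space, of codimension \<open>0\<close>.\<close>

definition dependence_matroid :: "('k::field ^ 'n) set set \<Rightarrow> ('k ^ 'n) set matroid" where
  "dependence_matroid \<A> = Matroid \<A> (\<lambda>\<B>. \<B> \<subseteq> \<A> \<and> codimension (\<Inter>\<B>) = card \<B>)"

definition divisionally_free :: "('k::field ^ 'n) set set \<Rightarrow> bool" where
  "divisionally_free \<A> \<longleftrightarrow> has_divisional_flag (dependence_matroid \<A>)"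

end

theory Submission
  imports Defs
begin

text \<open>
  The induction over modularly extended matroids proves more: for every round modular flat
  \<open>X\<close> there is a chain of flats \<open>{} = Y\<^sub>0 \<subset> Y\<^sub>1
  \<subset> \<dots>\<close> of ranks \<open>0, 1, \<dots>, r(E) - r(X)\<close>, all disjoint
  from \<open>X\<close>, along which the characteristic polynomials of the contractions divide
  each other; the case \<open>X = {}\<close> is the theorem. In a modular join over
  \<open>E\<^sub>1 \<inter> E\<^sub>2\<close> the round flat \<open>X\<close> lies in one
  side, say \<open>E\<^sub>1\<close>. A chain in \<open>E\<^sub>2\<close> avoiding
  \<open>E\<^sub>1 \<inter> E\<^sub>2\<close> ends in a complement \<open>Y\<close> of
  \<open>E\<^sub>1\<close>; the map \<open>F \<mapsto> F \<or> Y\<close> identifies the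
  lattices of flats of \<open>M|E\<^sub>1\<close> and \<open>M/Y\<close>, so a chain of
  \<open>M|E\<^sub>1\<close> avoiding \<open>X\<close> continues it. For a modular coatom
  \<open>H\<close>, if some atom \<open>c\<close> lies outside \<open>H \<union> X\<close>,
  contract \<open>c\<close> and project \<open>X\<close> from \<open>c\<close> to
  \<open>H\<close>, which preserves roundness and modularity; otherwise \<open>M\<close> is the
  union of \<open>X\<close> and \<open>H\<close> and a chain of \<open>M|H\<close> avoiding
  \<open>X \<inter> H\<close> already works.

  Divisibility rests on the identity that the sum of \<open>\<chi>(M/Y, t)\<close> over the flats
  \<open>Y \<supseteq> F\<close> is \<open>t\<close> to the power \<open>r(E) - r(F)\<close>,
  which determines these polynomials by induction from the top.
\<close>

section \<open>Rank, closure and modular flats\<close>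

lemma flat_subset: "flat M F \<Longrightarrow> F \<subseteq> ground M"
  by (simp add: flat_def)

context
  fixes M :: "'a matroid"
  assumes M: "is_matroid M"
begin

lemma finite_ground: "finite (ground M)"
  using M unfolding is_matroid_def by blast

lemma indep_ground: "indep M A \<Longrightarrow> A \<subseteq> ground M"
  using M unfolding is_matroid_def by blast

lemma indep_empty: "indep M {}"
  using M unfolding is_matroid_def by blast

lemma indep_mono: "indep M B \<Longrightarrow> A \<subseteq> B \<Longrightarrow> indep M A"
  using M unfolding is_matroid_def by blast

lemma indep_augment:
  "indep M A \<Longrightarrow> indep M B \<Longrightarrow> card A < card B \<Longrightarrow> \<exists>x\<in>B - A. indep M (insert x A)"
  using M unfolding is_matroid_def by blast

lemma finite_indep: "indep M A \<Longrightarrow> finite A"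
  using finite_ground indep_ground finite_subset by blast

lemma finite_indep_subsets: "finite {B. B \<subseteq> A \<and> indep M B}"
  by (rule finite_subset[of _ "Pow (ground M)"]) (auto dest: indep_ground simp: finite_ground)

lemma card_le_rk: "B \<subseteq> A \<Longrightarrow> indep M B \<Longrightarrow> card B \<le> rk M A"
  unfolding rk_def by (rule Max_ge) (auto simp: finite_indep_subsets)

lemma rk_basis: "\<exists>B\<subseteq>A. indep M B \<and> card B = rk M A"
proof -
  have "rk M A \<in> card ` {B. B \<subseteq> A \<and> indep M B}"
    unfolding rk_def by (rule Max_in) (use indep_empty finite_indep_subsets in auto)
  then show ?thesis by auto
qed

text \<open>A largest independent set between \<open>I\<close> and \<open>A\<close> works: were it
  smaller than a maximum independent subset of \<open>A\<close>, augmentation would enlarge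
  it.\<close>

lemma indep_extend:
  assumes "indep M I" "I \<subseteq> A"
  shows "\<exists>B. I \<subseteq> B \<and> B \<subseteq> A \<and> indep M B \<and> card B = rk M A"
proof -
  let ?S = "{B. I \<subseteq> B \<and> B \<subseteq> A \<and> indep M B}"
  have fin: "finite ?S"
    by (rule finite_subset[OF _ finite_indep_subsets[of A]]) auto
  have "Max (card ` ?S) \<in> card ` ?S"
    by (rule Max_in) (use fin assms in auto)
  then obtain B where B: "B \<in> ?S" "card B = Max (card ` ?S)"
    by force
  have max: "card C \<le> card B" if "C \<in> ?S" for C
    using that fin B(2) by simp
  obtain J where J: "J \<subseteq> A" "indep M J" "card J = rk M A"
    using rk_basis by blast
  have "card B \<ge> rk M A"
  proof (rule ccontr)
    assume "\<not> ?thesis"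
    then obtain x where x: "x \<in> J - B" "indep M (insert x B)"
      using indep_augment[of B J] B J by auto
    then have "insert x B \<in> ?S"
      using B J by auto
    from max[OF this] x(1) finite_indep[of B] B(1) show False
      by simp
  qed
  with card_le_rk[of B A] B(1) show ?thesis
    by (intro exI[of _ B]) auto
qed

lemma rk_mono: "A \<subseteq> B \<Longrightarrow> rk M A \<le> rk M B"
proof -
  assume "A \<subseteq> B"
  moreover obtain I where "I \<subseteq> A" "indep M I" "card I = rk M A"
    using rk_basis by blast
  ultimately show ?thesis using card_le_rk[of I B] by auto
qed

text \<open>Extend a basis of \<open>A \<inter> B\<close> to a basis \<open>J\<close> of
  \<open>A \<union> B\<close> and count the independent sets \<open>J \<inter> A\<close> and
  \<open>J \<inter> B\<close>.\<close>

lemma rk_submodular: "rk M (A \<union> B) + rk M (A \<inter> B) \<le> rk M A + rk M B"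
proof -
  obtain I where I: "I \<subseteq> A \<inter> B" "indep M I" "card I = rk M (A \<inter> B)"
    using rk_basis by blast
  then obtain J where J: "I \<subseteq> J" "J \<subseteq> A \<union> B" "indep M J" "card J = rk M (A \<union> B)"
    using indep_extend[of I "A \<union> B"] by auto
  have fin: "finite J" using J finite_indep by blast
  have "card J + card I \<le> card (J \<inter> A \<union> J \<inter> B) + card ((J \<inter> A) \<inter> (J \<inter> B))"
    using I J fin by (intro add_mono card_mono) auto
  also have "\<dots> = card (J \<inter> A) + card (J \<inter> B)"
    using fin by (intro card_Un_Int[symmetric]) auto
  also have "\<dots> \<le> rk M A + rk M B"
    using J by (intro add_mono card_le_rk) (auto intro: indep_mono)
  finally show ?thesis using I J by simp
qed

lemma rk_le_card: "finite A \<Longrightarrow> rk M A \<le> card A"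
proof -
  obtain I where "I \<subseteq> A" "card I = rk M A"
    using rk_basis by blast
  moreover assume "finite A"
  ultimately show ?thesis using card_mono[of A I] by simp
qed

lemma rk_empty: "rk M {} = 0"
  using rk_le_card[of "{}"] by simp

lemma rk_insert_le: "rk M (insert e A) \<le> Suc (rk M A)"
  using rk_submodular[of "{e}" A] rk_le_card[of "{e}"] by simp

lemma rk_insert_eq_mono:
  assumes "rk M (insert e A) = rk M A" "A \<subseteq> B"
  shows "rk M (insert e B) = rk M B"
proof -
  have "rk M (insert e A \<union> B) + rk M (insert e A \<inter> B) \<le> rk M A + rk M B"
    using rk_submodular[of "insert e A" B] assms(1) by simp
  moreover have "insert e A \<union> B = insert e B" using assms by auto
  moreover have "rk M A \<le> rk M (insert e A \<inter> B)" using assms by (intro rk_mono) auto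
  moreover have "rk M B \<le> rk M (insert e B)" by (intro rk_mono) auto
  ultimately show ?thesis by simp
qed

lemma rk_Un_eq:
  assumes "finite B" "\<And>e. e \<in> B \<Longrightarrow> rk M (insert e A) = rk M A"
  shows "rk M (A \<union> B) = rk M A"
  using assms
proof (induction B)
  case (insert x B)
  have "rk M (insert x (A \<union> B)) = rk M (A \<union> B)"
    by (rule rk_insert_eq_mono[of x A]) (simp_all add: insert.prems)
  moreover have "rk M (A \<union> B) = rk M A"
    by (rule insert.IH) (simp add: insert.prems)
  ultimately show ?case by simp
qed simp

lemma cl_subset_ground: "cl M A \<subseteq> ground M"
  by (auto simp: cl_def)

lemma subset_cl: "A \<subseteq> ground M \<Longrightarrow> A \<subseteq> cl M A"
  by (auto simp: cl_def insert_absorb)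

lemma rk_Un_cl: "rk M (A \<union> cl M A) = rk M A"
  by (rule rk_Un_eq) (use cl_subset_ground finite_ground finite_subset in \<open>auto simp: cl_def\<close>)

lemma rk_cl: "A \<subseteq> ground M \<Longrightarrow> rk M (cl M A) = rk M A"
  using rk_Un_cl[of A] subset_cl[of A] by (simp add: Un_absorb1)

lemma flat_ground: "flat M (ground M)"
  by (auto simp: flat_def cl_def insert_absorb)



lemma finite_flats: "finite {F. flat M F \<and> P F}"
  by (rule finite_subset[of _ "Pow (ground M)"]) (auto dest: flat_subset simp: finite_ground)

lemma flatI:
  assumes "F \<subseteq> ground M" "\<And>e. e \<in> ground M \<Longrightarrow> e \<notin> F \<Longrightarrow> rk M (insert e F) \<noteq> rk M F"
  shows "flat M F"
  using assms subset_cl[of F] by (auto simp: flat_def cl_def)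

lemma flat_memI: "flat M F \<Longrightarrow> e \<in> ground M \<Longrightarrow> rk M (insert e F) = rk M F \<Longrightarrow> e \<in> F"
  by (auto simp: flat_def cl_def)

text \<open>For each \<open>e \<in> A\<close> the rank of \<open>insert e F\<close> is squeezed
  between those of \<open>F\<close> and \<open>A\<close>, so flatness puts \<open>e\<close> into
  \<open>F\<close>.\<close>

lemma flat_rk_le_subset:
  assumes "flat M F" "F \<subseteq> A" "A \<subseteq> ground M" "rk M A \<le> rk M F"
  shows "A \<subseteq> F"
proof
  fix e assume e: "e \<in> A"
  have "rk M F \<le> rk M (insert e F)" "rk M (insert e F) \<le> rk M A"
    using e assms by (simp_all add: rk_mono subset_insertI)
  then have "rk M (insert e F) = rk M F" using assms by simp
  with e assms show "e \<in> F" using flat_memI by blast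
qed

lemma flat_eqI: "flat M F \<Longrightarrow> flat M G \<Longrightarrow> F \<subseteq> G \<Longrightarrow> rk M G \<le> rk M F \<Longrightarrow> F = G"
  using flat_rk_le_subset flat_subset by blast

lemma flat_rk_less: "flat M F \<Longrightarrow> F \<subset> A \<Longrightarrow> A \<subseteq> ground M \<Longrightarrow> rk M F < rk M A"
  using flat_rk_le_subset[of F A] by (meson leD leI psubsetE)

lemma rk_insert_flat:
  "flat M F \<Longrightarrow> e \<in> ground M \<Longrightarrow> e \<notin> F \<Longrightarrow> rk M (insert e F) = Suc (rk M F)"
  using flat_rk_less[of F "insert e F"] rk_insert_le[of e F] flat_subset[of M F]
  by (simp add: psubset_insert_iff)

lemma cl_subset_flat:
  assumes "flat M F" "A \<subseteq> F"
  shows "cl M A \<subseteq> F"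
proof
  fix e assume "e \<in> cl M A"
  then have "e \<in> ground M" "rk M (insert e A) = rk M A" by (auto simp: cl_def)
  with assms show "e \<in> F" using flat_memI rk_insert_eq_mono[of e A F] by blast
qed

lemma flat_cl: "A \<subseteq> ground M \<Longrightarrow> flat M (cl M A)"
proof (rule flatI)
  fix e assume A: "A \<subseteq> ground M" and e: "e \<in> ground M" "e \<notin> cl M A"
  then have "rk M A < rk M (insert e A)"
    using rk_mono[of A "insert e A"] by (simp add: cl_def subset_insertI)
  also have "\<dots> \<le> rk M (insert e (cl M A))"
    using subset_cl[OF A] by (intro rk_mono) auto
  finally show "rk M (insert e (cl M A)) \<noteq> rk M (cl M A)"
    using rk_cl[OF A] by simp
qed (rule cl_subset_ground)

lemma cl_flat: "flat M F \<Longrightarrow> cl M F = F"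
  by (simp add: flat_def)

lemma cl_mono: "A \<subseteq> B \<Longrightarrow> B \<subseteq> ground M \<Longrightarrow> cl M A \<subseteq> cl M B"
  using cl_subset_flat[of "cl M B" A] flat_cl[of B] subset_cl[of B] by auto

lemma flat_Int:
  assumes "flat M F" "flat M G"
  shows "flat M (F \<inter> G)"
proof (rule flatI)
  fix e assume e: "e \<in> ground M" "e \<notin> F \<inter> G"
  then show "rk M (insert e (F \<inter> G)) \<noteq> rk M (F \<inter> G)"
    using assms flat_memI rk_insert_eq_mono[of e "F \<inter> G"] by blast
qed (use assms flat_subset in blast)

lemma rk_Un_cl_right: "A \<subseteq> ground M \<Longrightarrow> B \<subseteq> ground M \<Longrightarrow> rk M (A \<union> cl M B) = rk M (A \<union> B)"
proof (rule antisym)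
  assume AB: "A \<subseteq> ground M" "B \<subseteq> ground M"
  have "A \<union> cl M B \<subseteq> cl M (A \<union> B)"
    using subset_cl[of "A \<union> B"] cl_mono[of B "A \<union> B"] AB by auto
  then show "rk M (A \<union> cl M B) \<le> rk M (A \<union> B)"
    using rk_mono rk_cl[of "A \<union> B"] AB by (metis Un_least)
  show "rk M (A \<union> B) \<le> rk M (A \<union> cl M B)"
    using subset_cl AB by (intro rk_mono) auto
qed



section \<open>Modular flats and the modular law\<close>

lemma modular_flat_iff:
  "modular_flat M X \<longleftrightarrow> flat M X \<and> (\<forall>Y. flat M Y \<longrightarrow> rk M X + rk M Y = rk M (X \<inter> Y) + rk M (X \<union> Y))"
  unfolding modular_flat_def flat_join_def
  using rk_cl flat_subset by (metis Un_least)

lemma modular_flat_rk: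
  "modular_flat M X \<Longrightarrow> flat M Y \<Longrightarrow> rk M X + rk M Y = rk M (X \<inter> Y) + rk M (X \<union> Y)"
  by (simp add: modular_flat_iff)

text \<open>Let \<open>?W\<close> be the join of \<open>F\<close> and \<open>Y\<close>. Modularity
  of \<open>G\<close> is used against \<open>Y\<close> and against \<open>?W\<close>, which have the
  same join with \<open>G\<close>; comparing the two equations turns submodularity for
  \<open>F\<close> and \<open>Y\<close> into an upper bound on the rank of
  \<open>G \<inter> ?W\<close>. As \<open>F \<subseteq> G \<inter> ?W\<close>, this forces
  equality.\<close>

lemma
  assumes G: "modular_flat M G" and Y: "flat M Y" and F: "flat M F" and sub: "Y \<inter> G \<subseteq> F" "F \<subseteq> G"
  shows modular_law: "cl M (F \<union> Y) \<inter> G = F"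
    and modular_rk_Un: "rk M (F \<union> Y) + rk M (Y \<inter> G) = rk M F + rk M Y"
proof -
  let ?W = "cl M (F \<union> Y)"
  have g: "G \<subseteq> ground M" "Y \<subseteq> ground M" "F \<subseteq> ground M" "flat M G"
    using assms flat_subset[of M] by (simp_all add: modular_flat_iff)
  have W: "flat M ?W" "rk M ?W = rk M (F \<union> Y)" "F \<union> Y \<subseteq> ?W"
    using g flat_cl rk_cl subset_cl[of "F \<union> Y"] by auto
  have "rk M (G \<union> ?W) = rk M (G \<union> Y)"
    using g sub rk_Un_cl_right[of G "F \<union> Y"] by (simp add: Un_absorb2 flip: Un_assoc)
  then have e: "rk M G + rk M Y = rk M (G \<inter> Y) + rk M (G \<union> Y)"
    "rk M G + rk M ?W = rk M (G \<inter> ?W) + rk M (G \<union> Y)"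
    using modular_flat_rk[OF G Y] modular_flat_rk[OF G W(1)] by simp_all
  have "F \<inter> Y = G \<inter> Y" using sub by auto
  then have s: "rk M (F \<union> Y) + rk M (G \<inter> Y) \<le> rk M F + rk M Y"
    using rk_submodular[of F Y] by simp
  have "rk M (G \<inter> ?W) \<le> rk M F"
    using s e W by simp
  then have "F = G \<inter> ?W"
    using F W sub flat_Int g by (intro flat_eqI) auto
  then show "?W \<inter> G = F" by auto
  with e W show "rk M (F \<union> Y) + rk M (Y \<inter> G) = rk M F + rk M Y"
    by (simp add: Int_commute)
qed

end

section \<open>Restriction and contraction\<close>

text \<open>Induction from the top of the lattice of flats, on the number of elements outside
  \<open>Z\<close>. No separate base case arises, since no flat lies above the ground set.\<close>

lemma flat_upward_induct [consumes 2, case_names flat]: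
  assumes M: "is_matroid M" and "flat M Z"
    and step: "\<And>Z. flat M Z \<Longrightarrow> (\<And>W. flat M W \<Longrightarrow> Z \<subset> W \<Longrightarrow> P W) \<Longrightarrow> P Z"
  shows "P Z"
  using assms(2)
proof (induction "card (ground M - Z)" arbitrary: Z rule: less_induct)
  case less
  show ?case
  proof (rule step[OF less.prems])
    fix W assume W: "flat M W" "Z \<subset> W"
    then have "ground M - W \<subset> ground M - Z" using flat_subset[of M W] by blast
    with W show "P W"
      by (intro less.hyps) (auto intro: psubset_card_mono simp: finite_ground[OF M])
  qed
qed

lemma ground_restriction [simp]: "ground (restriction M G) = G"
  by (simp add: restriction_def)

lemma restriction_restriction: "X \<subseteq> G \<Longrightarrow> restriction (restriction M G) X = restriction M X"
  by (auto simp: restriction_def)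

lemma rk_restriction: "A \<subseteq> G \<Longrightarrow> rk (restriction M G) A = rk M A"
  unfolding rk_def restriction_def by (auto intro!: arg_cong[where f = Max] arg_cong[where f = "image card"])

lemma matroid_restriction:
  assumes "is_matroid M" "G \<subseteq> ground M"
  shows "is_matroid (restriction M G)"
  unfolding is_matroid_def
proof (intro conjI allI impI)
  show "finite (ground (restriction M G))"
    using assms finite_ground finite_subset by auto
next
  fix A B assume a: "indep (restriction M G) A \<and> indep (restriction M G) B \<and> card A < card B"
  then obtain x where "x \<in> B - A" "indep M (insert x A)"
    using indep_augment[OF assms(1), of A B] by (auto simp: restriction_def)
  with a show "\<exists>x\<in>B - A. indep (restriction M G) (insert x A)"
    by (auto simp: restriction_def)
qed (use assms indep_empty indep_mono in \<open>auto simp: restriction_def\<close>)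

lemma flat_restriction:
  assumes M: "is_matroid M" and G: "flat M G"
  shows "flat (restriction M G) F \<longleftrightarrow> flat M F \<and> F \<subseteq> G"
proof -
  have "cl (restriction M G) F = cl M F \<inter> G" if "F \<subseteq> G"
    using that flat_subset[OF G] by (auto simp: cl_def rk_restriction)
  moreover have "cl M F \<subseteq> G" if "F \<subseteq> G"
    using M G that cl_subset_flat by blast
  moreover have "F \<subseteq> cl M F" if "F \<subseteq> G"
    using that M flat_subset[OF G] subset_cl[of M F] by blast
  ultimately have "cl (restriction M G) F = cl M F" if "F \<subseteq> G"
    using that by blast
  then show ?thesis
    using flat_subset[OF G] by (auto simp: flat_def)
qed

text \<open>A flat \<open>Y \<subseteq> G\<close> meets \<open>E\<close> inside
  \<open>E \<inter> G\<close>, so \<open>modular_rk_Un\<close> applies with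
  \<open>E \<inter> G\<close> as the intermediate flat.\<close>

lemma modular_flat_restriction:
  assumes M: "is_matroid M" and E: "modular_flat M E" and G: "flat M G"
  shows "modular_flat (restriction M G) (E \<inter> G)"
proof -
  have MG: "is_matroid (restriction M G)"
    using M G flat_subset matroid_restriction by blast
  have fE: "flat M E" using E by (simp add: modular_flat_def)
  note sub = flat_subset[OF G] flat_subset[OF fE]
  show ?thesis
    unfolding modular_flat_iff[OF MG] flat_restriction[OF M G]
  proof (intro conjI allI impI)
    fix Y assume Y: "flat M Y \<and> Y \<subseteq> G"
    have eq: "rk M (E \<inter> G \<union> Y) + rk M (Y \<inter> E) = rk M (E \<inter> G) + rk M Y"
      using Y flat_Int[OF M fE G] by (intro modular_rk_Un[OF M E]) auto
    have "E \<inter> G \<inter> Y = Y \<inter> E" using Y by auto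
    then show "rk (restriction M G) (E \<inter> G) + rk (restriction M G) Y =
        rk (restriction M G) (E \<inter> G \<inter> Y) + rk (restriction M G) (E \<inter> G \<union> Y)"
      using eq Y by (subst (1 2 3 4) rk_restriction) auto
  qed (use flat_Int[OF M fE G] in auto)
qed

lemma round_flat_iff:
  assumes "is_matroid M"
  shows "round_flat M S \<longleftrightarrow>
    flat M S \<and> \<not> (\<exists>F G. flat M F \<and> flat M G \<and> F \<noteq> S \<and> G \<noteq> S \<and> F \<union> G = S)"
  unfolding round_flat_def round_matroid_def
  using flat_restriction[OF assms, of S] by (metis Un_upper1 Un_upper2 ground_restriction)

lemma round_flat_restriction:
  assumes "is_matroid M" "flat M G" "X \<subseteq> G"
  shows "round_flat (restriction M G) X \<longleftrightarrow> round_flat M X"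
  using assms by (simp add: round_flat_def restriction_restriction flat_restriction)

section \<open>Rank, closure and flats of contractions\<close>

lemma ground_contraction [simp]: "ground (contraction M X) = ground M - X"
  by (simp add: contraction_def)

lemma rk_contraction:
  assumes M: "is_matroid M" and A: "A \<subseteq> ground M - X"
  shows "rk (contraction M X) A = rk M (A \<union> X) - rk M X"
proof -
  let ?I = "{B. B \<subseteq> A \<and> indep (contraction M X) B}"
  have finA: "finite A"
    using A finite_ground[OF M] finite_subset by blast
  \<comment> \<open>Greedy construction of a basis of \<open>A\<close> in the contraction: an
    element joins \<open>B\<close> exactly when it raises the rank of the earlier elements together
    with \<open>X\<close>.\<close>
  have "\<exists>B\<subseteq>A. rk M (B \<union> X) = card B + rk M X \<and> rk M (A \<union> X) = rk M (B \<union> X)"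
    using finA
  proof (induction A)
    case (insert a A)
    then obtain B where B: "B \<subseteq> A" "rk M (B \<union> X) = card B + rk M X" "rk M (A \<union> X) = rk M (B \<union> X)"
      by blast
    show ?case
    proof (cases "rk M (insert a (A \<union> X)) = rk M (A \<union> X)")
      case True
      with B show ?thesis by (intro exI[of _ B]) auto
    next
      case False
      then have "rk M (insert a (B \<union> X)) \<noteq> rk M (B \<union> X)"
        using B rk_insert_eq_mono[OF M, of a "B \<union> X" "A \<union> X"] by auto
      moreover have "finite B" "a \<notin> B" using B insert.hyps finite_subset by auto
      ultimately have "rk M (insert a B \<union> X) = card (insert a B) + rk M X"
        "rk M (insert a (A \<union> X)) = rk M (insert a (B \<union> X))"
        using False B rk_insert_le[OF M, of a "B \<union> X"] rk_insert_le[OF M, of a "A \<union> X"]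
          rk_mono[OF M, OF subset_insertI, of "B \<union> X" a]
          rk_mono[OF M, OF subset_insertI, of "A \<union> X" a]
        by auto
      with B show ?thesis by (intro exI[of _ "insert a B"]) auto
    qed
  qed auto
  then obtain B where B: "B \<subseteq> A" "rk M (B \<union> X) = card B + rk M X" "rk M (A \<union> X) = rk M (B \<union> X)"
    by blast
  have "Max (card ` ?I) = card B"
  proof (rule Max_eqI)
    show "finite (card ` ?I)"
      using finA by auto
    show "card B \<in> card ` ?I"
      using A B by (auto simp: contraction_def)
    fix k assume "k \<in> card ` ?I"
    then obtain C where C: "C \<subseteq> A" "k = card C" "rk M (C \<union> X) = card C + rk M X"
      by (auto simp: contraction_def)
    with rk_mono[OF M, of "C \<union> X" "A \<union> X"] B show "k \<le> card B"
      by auto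
  qed
  with B show ?thesis by (simp add: rk_def)
qed

lemma cl_contraction:
  assumes M: "is_matroid M" and A: "A \<subseteq> ground M - X" and X: "X \<subseteq> ground M"
  shows "cl (contraction M X) A = cl M (A \<union> X) - X"
proof -
  have "rk (contraction M X) (insert e A) = rk (contraction M X) A \<longleftrightarrow>
      rk M (insert e (A \<union> X)) = rk M (A \<union> X)" if "e \<in> ground M - X" for e
    using that A rk_mono[OF M, of X "insert e (A \<union> X)"] rk_mono[OF M, of X "A \<union> X"]
    by (auto simp: rk_contraction[OF M] subset_insertI2)
  then show ?thesis by (auto simp: cl_def)
qed

lemma flat_contraction_Diff:
  assumes M: "is_matroid M" and X: "X \<subseteq> ground M" and Z: "X \<subseteq> Z"
  shows "flat (contraction M X) (Z - X) \<longleftrightarrow> flat M Z"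
proof (cases "Z \<subseteq> ground M")
  case True
  then have "Z - X \<union> X = Z" "Z - X \<subseteq> ground M - X" using Z by auto
  with cl_contraction[OF M _ X, of "Z - X"] subset_cl[OF M True] True Z show ?thesis
    by (auto simp: flat_def)
qed (use X in \<open>auto simp: flat_def\<close>)

lemma bij_betw_flats_contraction:
  assumes M: "is_matroid M" and X: "X \<subseteq> ground M"
  shows "bij_betw (\<lambda>Z. Z - X) {Z. flat M Z \<and> X \<subseteq> Z} {W. flat (contraction M X) W}"
  unfolding bij_betw_def
proof (intro conjI equalityI subsetI)
  fix W assume "W \<in> {W. flat (contraction M X) W}"
  moreover from this have "W \<union> X - X = W" by (auto simp: flat_def)
  ultimately show "W \<in> (\<lambda>Z. Z - X) ` {Z. flat M Z \<and> X \<subseteq> Z}"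
    using flat_contraction_Diff[OF M X, of "W \<union> X"] by (intro image_eqI[of _ _ "W \<union> X"]) auto
qed (use flat_contraction_Diff[OF M X] in \<open>auto simp: inj_on_def\<close>)

section \<open>Characteristic polynomials of contractions\<close>

abbreviation contraction_poly :: "'a matroid \<Rightarrow> 'a set \<Rightarrow> int poly" where
  "contraction_poly M F \<equiv> characteristic_polynomial (contraction M F)"

context
  fixes M :: "'a matroid" and F :: "'a set"
  assumes M: "is_matroid M" and F: "flat M F"
begin

text \<open>Indexing by flats of \<open>M\<close> above \<open>F\<close> lets the polynomials of
  different contractions be compared inside one lattice.\<close>

lemma contraction_poly_eq:
  "contraction_poly M F = (\<Sum>Z | flat M Z \<and> F \<subseteq> Z.
     monom (moebius (contraction M F) (Z - F)) (rk M (ground M) - rk M Z))"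
proof -
  note sub = flat_subset[OF F]
  have rank: "rk (contraction M F) (ground (contraction M F)) - rk (contraction M F) (Z - F)
      = rk M (ground M) - rk M Z" if Z: "flat M Z \<and> F \<subseteq> Z" for Z
  proof -
    have "ground M - F \<union> F = ground M" "Z - F \<union> F = Z" "Z - F \<subseteq> ground M - F"
      using sub Z flat_subset[of M Z] by auto
    then show ?thesis
      using rk_mono[OF M, of F Z] rk_mono[OF M, of F "ground M"] Z sub
      by (simp add: rk_contraction[OF M])
  qed
  show ?thesis
    unfolding characteristic_polynomial_def
    by (subst sum.reindex_bij_betw[OF bij_betw_flats_contraction[OF M sub], symmetric])
      (intro sum.cong, use rank in auto)
qed

lemma cl_contraction_empty: "cl (contraction M F) {} = {}"
  using cl_contraction[OF M _ flat_subset[OF F], of "{}"] cl_flat[OF M F] by simp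

lemma moebius_contraction_bottom: "moebius (contraction M F) {} = 1"
  by (subst moebius.simps) (simp add: cl_contraction_empty)

text \<open>This is the recursion defining \<open>moebius\<close> at \<open>W - F\<close>,
  transported to \<open>M\<close> along the bijection \<open>Z \<mapsto> Z - F\<close>.\<close>

lemma sum_moebius_contraction:
  assumes W: "flat M W" "F \<subset> W"
  shows "(\<Sum>Y | flat M Y \<and> F \<subseteq> Y \<and> Y \<subseteq> W. moebius (contraction M F) (Y - F)) = 0"
proof -
  let ?m = "moebius (contraction M F)"
  let ?S = "{Y. flat M Y \<and> F \<subseteq> Y \<and> Y \<subset> W}"
  note sub = flat_subset[OF F]
  have fW: "finite W" using flat_subset[OF W(1)] finite_ground[OF M] finite_subset by blast
  have "bij_betw (\<lambda>Z. Z - F) ?S {Y. flat (contraction M F) Y \<and> Y \<subset> W - F}"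
  proof (rule bij_betw_imageI)
    show "(\<lambda>Z. Z - F) ` ?S = {Y. flat (contraction M F) Y \<and> Y \<subset> W - F}"
    proof (intro equalityI subsetI)
      fix Y assume Y: "Y \<in> {Y. flat (contraction M F) Y \<and> Y \<subset> W - F}"
      then have "Y \<union> F - F = Y" by auto
      moreover from this have "flat M (Y \<union> F)"
        using Y flat_contraction_Diff[OF M sub, of "Y \<union> F"] by auto
      moreover have "Y \<union> F \<subset> W" using Y W by auto
      ultimately show "Y \<in> (\<lambda>Z. Z - F) ` ?S"
        by (intro image_eqI[of _ _ "Y \<union> F"]) auto
    next
      fix Y assume "Y \<in> (\<lambda>Z. Z - F) ` ?S"
      then obtain Z where Z: "flat M Z" "F \<subseteq> Z" "Z \<subset> W" "Y = Z - F"
        by blast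
      then have "Y \<subset> W - F" by blast
      with Z show "Y \<in> {Y. flat (contraction M F) Y \<and> Y \<subset> W - F}"
        using flat_contraction_Diff[OF M sub, of Z] by simp
    qed
  qed (auto simp: inj_on_def)
  note bij = sum.reindex_bij_betw[OF this, of ?m]
  have "W - F \<noteq> {}" using W by auto
  then have "?m (W - F) = - (\<Sum>Y | flat (contraction M F) Y \<and> Y \<subset> W - F. ?m Y)"
    using fW by (subst moebius.simps) (simp add: cl_contraction_empty)
  then have eq: "?m (W - F) = - (\<Sum>Y\<in>?S. ?m (Y - F))"
    by (simp only: bij)
  have "{Y. flat M Y \<and> F \<subseteq> Y \<and> Y \<subseteq> W} = insert W ?S" using W by auto
  moreover have "finite ?S" "W \<notin> ?S" by (auto simp: finite_flats[OF M])
  ultimately show ?thesis using eq by simp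
qed

text \<open>The coefficient in the degree of the corank of \<open>F\<close> comes from the bottom
  flat \<open>Z = F\<close> alone and is 1. Nonvanishing serves to cancel such a polynomial from
  products.\<close>

lemma contraction_poly_nonzero: "contraction_poly M F \<noteq> 0"
proof -
  let ?n = "rk M (ground M)"
  have "coeff (contraction_poly M F) (?n - rk M F) =
     (\<Sum>Z | flat M Z \<and> F \<subseteq> Z. if Z = F then moebius (contraction M F) {} else 0)"
    unfolding contraction_poly_eq coeff_sum
  proof (rule sum.cong)
    fix Z assume "Z \<in> {Z. flat M Z \<and> F \<subseteq> Z}"
    then have "rk M F < rk M Z" if "Z \<noteq> F"
      using that flat_rk_less[OF M F, of Z] flat_subset[of M Z] by blast
    moreover have "rk M Z \<le> ?n"
      using \<open>Z \<in> _\<close> flat_subset by (auto intro: rk_mono[OF M])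
    ultimately show "coeff (monom (moebius (contraction M F) (Z - F)) (?n - rk M Z)) (?n - rk M F)
      = (if Z = F then moebius (contraction M F) {} else 0)"
      by (cases "Z = F") auto
  qed simp
  also have "\<dots> = 1"
    using F by (simp add: finite_flats[OF M] moebius_contraction_bottom)
  finally show ?thesis by auto
qed

end

text \<open>Weight the upper sums \<open>?D Y\<close> with the Moebius values \<open>?m Y\<close>.
  Exchanging sums leaves \<open>contraction_poly M F\<close>, which by definition is also the
  weighted sum of the powers \<open>?t Y\<close>. Strictly above \<open>F\<close> the two weighted
  sums agree by induction, so the terms at \<open>F\<close>, with weight 1, agree as well.\<close>

lemma sum_contraction_poly:
  assumes M: "is_matroid M" and F: "flat M F"
  shows "(\<Sum>Y | flat M Y \<and> F \<subseteq> Y. contraction_poly M Y) = monom 1 (rk M (ground M) - rk M F)"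
  using M F
proof (induction rule: flat_upward_induct)
  case (flat F)
  let ?t = "\<lambda>Z. monom (1::int) (rk M (ground M) - rk M Z)"
  let ?m = "\<lambda>Y. moebius (contraction M F) (Y - F)"
  let ?up = "\<lambda>F. {Y. flat M Y \<and> F \<subseteq> Y}"
  let ?D = "\<lambda>Y. \<Sum>W\<in>?up Y. contraction_poly M W"
  have fin: "finite (?up Y)" for Y by (rule finite_flats[OF M])
  have mt: "smult a (?t Y) = monom a (rk M (ground M) - rk M Y)" for a Y
    by (simp add: smult_monom)
  have split: "?up F = insert F (?up F - {F})" using flat.hyps by auto
  have "(\<Sum>Y\<in>?up F. smult (?m Y) (?D Y)) =
      (\<Sum>Y\<in>?up F. \<Sum>W\<in>{W\<in>?up F. Y \<subseteq> W}. smult (?m Y) (contraction_poly M W))"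
  proof (intro sum.cong refl)
    fix Y assume "Y \<in> ?up F"
    then have "?up Y = {W\<in>?up F. Y \<subseteq> W}" by auto
    moreover have "smult a (sum f A) = (\<Sum>x\<in>A. smult a (f x))"
      for a and f :: "'a set \<Rightarrow> int poly" and A
      using sum_distrib_left[of "[:a:]" f A] by simp
    ultimately show "smult (?m Y) (?D Y) =
        (\<Sum>W\<in>{W\<in>?up F. Y \<subseteq> W}. smult (?m Y) (contraction_poly M W))"
      by simp
  qed
  \<comment> \<open>After the exchange the inner sum runs over the interval from \<open>F\<close> to
    \<open>W\<close>, where the Moebius values cancel unless \<open>W = F\<close>.\<close>
  also have "\<dots> = (\<Sum>W\<in>?up F. \<Sum>Y\<in>{Y\<in>?up F. Y \<subseteq> W}. smult (?m Y) (contraction_poly M W))"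
    by (rule sum.swap_restrict) (auto simp: fin)
  also have "\<dots> = (\<Sum>W\<in>?up F. if W = F then contraction_poly M F else 0)"
  proof (rule sum.cong)
    fix W assume W: "W \<in> ?up F"
    have "(\<Sum>Y\<in>{Y\<in>?up F. Y \<subseteq> W}. smult (?m Y) (contraction_poly M W)) =
        smult (\<Sum>Y\<in>{Y\<in>?up F. Y \<subseteq> W}. ?m Y) (contraction_poly M W)"
      by (simp add: smult_sum)
    moreover have "(\<Sum>Y\<in>{Y\<in>?up F. Y \<subseteq> W}. ?m Y) = (if W = F then 1 else 0)"
    proof (cases "W = F")
      case True
      then have "{Y\<in>?up F. Y \<subseteq> W} = {F}" using flat.hyps by auto
      then show ?thesis using True moebius_contraction_bottom[OF M flat.hyps] by simp
    next
      case False
      then show ?thesis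
        using W sum_moebius_contraction[OF M flat.hyps, of W] by (auto simp: conj_assoc)
    qed
    ultimately show "(\<Sum>Y\<in>{Y\<in>?up F. Y \<subseteq> W}. smult (?m Y) (contraction_poly M W))
      = (if W = F then contraction_poly M F else 0)" by simp
  qed simp
  also have "\<dots> = contraction_poly M F"
    using flat.hyps by (simp add: fin)
  finally have 1: "(\<Sum>Y\<in>?up F. smult (?m Y) (?D Y)) = contraction_poly M F" .
  have "(\<Sum>Y\<in>?up F. smult (?m Y) (?D Y)) = ?D F + (\<Sum>Y\<in>?up F - {F}. smult (?m Y) (?D Y))"
    by (subst split, subst sum.insert) (auto simp: fin moebius_contraction_bottom[OF M flat.hyps])
  also have "(\<Sum>Y\<in>?up F - {F}. smult (?m Y) (?D Y)) = (\<Sum>Y\<in>?up F - {F}. smult (?m Y) (?t Y))"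
    by (intro sum.cong refl arg_cong2[where f = smult] flat.IH) auto
  finally have 2: "contraction_poly M F = ?D F + (\<Sum>Y\<in>?up F - {F}. smult (?m Y) (?t Y))"
    using 1 by simp
  have "contraction_poly M F = (\<Sum>Y\<in>?up F. smult (?m Y) (?t Y))"
    by (simp add: contraction_poly_eq[OF M flat.hyps] mt)
  also have "\<dots> = ?t F + (\<Sum>Y\<in>?up F - {F}. smult (?m Y) (?t Y))"
    by (subst split, subst sum.insert) (auto simp: fin moebius_contraction_bottom[OF M flat.hyps])
  finally show ?case using 2 by simp
qed

text \<open>Moebius inversion without a Moebius function: going down from the maximal members of
  \<open>S\<close>, the terms strictly above \<open>Z\<close> already agree and can be
  subtracted.\<close>

lemma upper_sum_eqD:
  fixes f g :: "'a set \<Rightarrow> 'b::ab_group_add"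
  assumes S: "finite S" and Z: "Z \<in> S"
    and eq: "\<And>Z. Z \<in> S \<Longrightarrow> (\<Sum>W\<in>{W\<in>S. Z \<subseteq> W}. f W) = (\<Sum>W\<in>{W\<in>S. Z \<subseteq> W}. g W)"
  shows "f Z = g Z"
  using Z
proof (induction "card {W\<in>S. Z \<subset> W}" arbitrary: Z rule: less_induct)
  case less
  let ?T = "{W\<in>S. Z \<subset> W}"
  have "f W = g W" if "W \<in> ?T" for W
  proof (rule less.hyps)
    have "{V\<in>S. W \<subset> V} \<subset> ?T" using that by auto
    then show "card {V\<in>S. W \<subset> V} < card ?T" using S by (intro psubset_card_mono) auto
  qed (use that in auto)
  then have "sum f ?T = sum g ?T" by (intro sum.cong) auto
  moreover have "{W\<in>S. Z \<subseteq> W} = insert Z ?T" using less.prems by auto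
  moreover have "finite ?T" "Z \<notin> ?T" using S by auto
  ultimately show ?case using eq[OF less.prems] by simp
qed

lemma sum_contraction_poly_restriction:
  assumes M: "is_matroid M" and G: "flat M G" and F: "flat M F" "F \<subseteq> G"
  shows "(\<Sum>Y | flat M Y \<and> F \<subseteq> Y \<and> Y \<subseteq> G. contraction_poly (restriction M G) Y) =
    monom 1 (rk M G - rk M F)"
proof -
  have MG: "is_matroid (restriction M G)"
    by (rule matroid_restriction[OF M flat_subset[OF G]])
  have "{Y. flat (restriction M G) Y \<and> F \<subseteq> Y} = {Y. flat M Y \<and> F \<subseteq> Y \<and> Y \<subseteq> G}"
    by (auto simp: flat_restriction[OF M G])
  with sum_contraction_poly[OF MG, of F] F show ?thesis
    by (simp add: flat_restriction[OF M G] rk_restriction)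
qed

section \<open>Complements of a modular flat\<close>

context
  fixes M :: "'a matroid" and G Y :: "'a set"
  assumes M: "is_matroid M" and G: "modular_flat M G" and Y: "flat M Y"
    and disj: "Y \<inter> G = {}" and rank: "rk M G + rk M Y = rk M (ground M)"
begin

lemma flat_modular: "flat M G"
  using G by (simp add: modular_flat_def)

lemma rk_Un_complement: "flat M F \<Longrightarrow> F \<subseteq> G \<Longrightarrow> rk M (F \<union> Y) = rk M F + rk M Y"
  using modular_rk_Un[OF M G Y, of F] disj rk_empty[OF M] by simp

lemma complement_modular_law: "flat M F \<Longrightarrow> F \<subseteq> G \<Longrightarrow> cl M (F \<union> Y) \<inter> G = F"
  using modular_law[OF M G Y, of F] disj by simp

text \<open>Since \<open>G \<union> Y\<close> has full rank, so has \<open>G \<union> V\<close>, and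
  modularity of \<open>G\<close> against \<open>V\<close> fixes the rank of
  \<open>V \<inter> G\<close>. Then \<open>V \<inter> G \<union> Y\<close> is a subset of
  \<open>V\<close> of the same rank. With \<open>complement_modular_law\<close> this makes joining
  with \<open>Y\<close> and intersecting with \<open>G\<close> mutually inverse.\<close>

lemma
  assumes V: "flat M V" "Y \<subseteq> V"
  shows cl_Int_Un_complement: "cl M (V \<inter> G \<union> Y) = V"
    and rk_Int_complement: "rk M V = rk M (V \<inter> G) + rk M Y"
proof -
  note sub = flat_subset[OF V(1)] flat_subset[OF flat_modular]
  have VG: "flat M (V \<inter> G)" by (rule flat_Int[OF M V(1) flat_modular])
  have r: "rk M (V \<inter> G \<union> Y) = rk M (V \<inter> G) + rk M Y"
    using VG by (intro rk_Un_complement) auto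
  have "rk M (G \<union> Y) = rk M (ground M)"
    using rk_Un_complement[OF flat_modular] rank by simp
  moreover have "rk M (G \<union> Y) \<le> rk M (G \<union> V)" "rk M (G \<union> V) \<le> rk M (ground M)"
    using V sub by (auto intro!: rk_mono[OF M])
  ultimately have "rk M G + rk M V = rk M (V \<inter> G) + rk M (ground M)"
    using modular_flat_rk[OF M G V(1)] by (simp add: Int_commute)
  then show rV: "rk M V = rk M (V \<inter> G) + rk M Y"
    using rank by simp
  have W: "V \<inter> G \<union> Y \<subseteq> V" using V by auto
  show "cl M (V \<inter> G \<union> Y) = V"
  proof (rule flat_eqI[OF M])
    show "flat M (cl M (V \<inter> G \<union> Y))" using W sub by (intro flat_cl[OF M]) auto
    show "cl M (V \<inter> G \<union> Y) \<subseteq> V" by (rule cl_subset_flat[OF M V(1) W])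
    have "rk M (cl M (V \<inter> G \<union> Y)) = rk M (V \<inter> G \<union> Y)"
      using W sub by (intro rk_cl[OF M]) auto
    with r rV show "rk M V \<le> rk M (cl M (V \<inter> G \<union> Y))" by simp
  qed (rule V(1))
qed

text \<open>Joining with \<open>Y\<close> maps the flats inside \<open>G\<close> bijectively onto
  the flats above \<open>Y\<close> and preserves coranks, as it adds \<open>rk M Y\<close> to every
  rank. Both sides therefore have the same upper sums.\<close>

lemma contraction_poly_complement:
  assumes F: "flat M F" "F \<subseteq> G"
  shows "contraction_poly (restriction M G) F = contraction_poly M (cl M (F \<union> Y))"
proof (rule upper_sum_eqD[of "{F. flat M F \<and> F \<subseteq> G}" F _ "\<lambda>F. contraction_poly M (cl M (F \<union> Y))"])
  fix Z assume "Z \<in> {F. flat M F \<and> F \<subseteq> G}"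
  then have Z: "flat M Z" "Z \<subseteq> G" by auto
  note sub = flat_subset[OF Y] flat_subset[OF flat_modular]
  let ?A = "{W \<in> {F. flat M F \<and> F \<subseteq> G}. Z \<subseteq> W}"
  let ?B = "{V. flat M V \<and> cl M (Z \<union> Y) \<subseteq> V}"
  have ZY: "Z \<union> Y \<subseteq> ground M" "Z \<union> Y \<subseteq> cl M (Z \<union> Y)"
    using Z sub subset_cl[OF M, of "Z \<union> Y"] by auto
  have "bij_betw (\<lambda>W. cl M (W \<union> Y)) ?A ?B"
  proof (rule bij_betw_byWitness[where f' = "\<lambda>V. V \<inter> G"])
    show "\<forall>W\<in>?A. cl M (W \<union> Y) \<inter> G = W"
      using complement_modular_law by blast
    show "\<forall>V\<in>?B. cl M (V \<inter> G \<union> Y) = V"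
      using cl_Int_Un_complement ZY by blast
    show "(\<lambda>W. cl M (W \<union> Y)) ` ?A \<subseteq> ?B"
    proof clarify
      fix W assume W: "flat M W" "W \<subseteq> G" "Z \<subseteq> W"
      then have "Z \<union> Y \<subseteq> W \<union> Y" "W \<union> Y \<subseteq> ground M" using sub by auto
      then show "flat M (cl M (W \<union> Y)) \<and> cl M (Z \<union> Y) \<subseteq> cl M (W \<union> Y)"
        using flat_cl[OF M] cl_mono[OF M] by simp
    qed
    show "(\<lambda>V. V \<inter> G) ` ?B \<subseteq> ?A"
      using flat_Int[OF M _ flat_modular] ZY Z by blast
  qed
  then have "(\<Sum>W\<in>?A. contraction_poly M (cl M (W \<union> Y))) = (\<Sum>V\<in>?B. contraction_poly M V)"
    by (rule sum.reindex_bij_betw)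
  also have "\<dots> = monom 1 (rk M (ground M) - rk M (cl M (Z \<union> Y)))"
    using flat_cl[OF M ZY(1)] by (rule sum_contraction_poly[OF M])
  also have "rk M (ground M) - rk M (cl M (Z \<union> Y)) = rk M G - rk M Z"
    using rk_cl[OF M ZY(1)] rk_Un_complement[OF Z] rank by simp
  finally show "(\<Sum>W\<in>?A. contraction_poly (restriction M G) W) = (\<Sum>W\<in>?A. contraction_poly M (cl M (W \<union> Y)))"
    using sum_contraction_poly_restriction[OF M flat_modular Z]
    by (simp add: conj_ac)
qed (use F finite_flats[OF M] in auto)

end

text \<open>Both sides, as functions of the intersection \<open>Z\<close> with \<open>G\<close> in place of \<open>F \<inter> G\<close>, have the same
  sums over the flats of \<open>G\<close> above any given one, hence they agree by Moebius inversion.\<close>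

lemma sum_contraction_poly_modular_fibre:
  assumes M: "is_matroid M" and G: "modular_flat M G" and F: "flat M F"
  shows "(\<Sum>Y | flat M Y \<and> F \<subseteq> Y \<and> Y \<inter> G = F \<inter> G. contraction_poly M Y) =
    contraction_poly (restriction M G) (F \<inter> G) * monom 1 (rk M (ground M) - rk M (F \<union> G))"
proof (rule upper_sum_eqD[of "{Z. flat M Z \<and> F \<inter> G \<subseteq> Z \<and> Z \<subseteq> G}" "F \<inter> G"
      "\<lambda>Z. \<Sum>Y | flat M Y \<and> F \<subseteq> Y \<and> Y \<inter> G = Z. contraction_poly M Y"])
  let ?S = "{Z. flat M Z \<and> F \<inter> G \<subseteq> Z \<and> Z \<subseteq> G}"
  let ?k = "rk M (ground M) - rk M (F \<union> G)"
  have fG: "flat M G" using G by (simp add: modular_flat_def)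
  note sub = flat_subset[OF F] flat_subset[OF fG]
  show "F \<inter> G \<in> ?S" using flat_Int[OF M F fG] by simp
  show "finite ?S" by (rule finite_flats[OF M])
  fix Z assume "Z \<in> ?S"
  then have Z: "flat M Z" "F \<inter> G \<subseteq> Z" "Z \<subseteq> G" by auto
  let ?A = "{W\<in>?S. Z \<subseteq> W}"
  let ?T = "{Y. flat M Y \<and> cl M (Z \<union> F) \<subseteq> Y}"
  have ZF: "Z \<union> F \<subseteq> ground M" using Z sub by auto
  have T: "cl M (Z \<union> F) \<subseteq> V \<longleftrightarrow> Z \<union> F \<subseteq> V" if "flat M V" for V
    using that cl_subset_flat[OF M, of V "Z \<union> F"] subset_cl[OF M ZF] by blast
  have "(\<Sum>W\<in>?A. \<Sum>Y | flat M Y \<and> F \<subseteq> Y \<and> Y \<inter> G = W. contraction_poly M Y) =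
      (\<Sum>W\<in>?A. \<Sum>Y\<in>{Y\<in>?T. Y \<inter> G = W}. contraction_poly M Y)"
    using T by (intro sum.cong refl) auto
  \<comment> \<open>The flats containing \<open>Z\<close> and \<open>F\<close> are grouped by their
    intersection with \<open>G\<close>.\<close>
  also have "\<dots> = (\<Sum>Y\<in>?T. contraction_poly M Y)"
  proof (rule sum.group)
    show "(\<lambda>Y. Y \<inter> G) ` ?T \<subseteq> ?A"
    proof (intro image_subsetI CollectI conjI)
      fix V assume V: "V \<in> ?T"
      then show "flat M (V \<inter> G)" using flat_Int[OF M _ fG] by simp
      have "Z \<union> F \<subseteq> V" using V T by blast
      then show "F \<inter> G \<subseteq> V \<inter> G" "Z \<subseteq> V \<inter> G" using Z by auto
    qed simp
    show "finite ?A"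
      by (rule finite_subset[OF _ finite_flats[OF M, of "\<lambda>Z. F \<inter> G \<subseteq> Z \<and> Z \<subseteq> G"]]) auto
  qed (rule finite_flats[OF M])
  also have "\<dots> = monom 1 (rk M (ground M) - rk M (cl M (Z \<union> F)))"
    using flat_cl[OF M ZF] by (rule sum_contraction_poly[OF M])
  \<comment> \<open>The exponent splits into the corank of \<open>Z\<close> in \<open>M|G\<close>
    and the part \<open>?k\<close>, which is the same for every \<open>Z\<close> and becomes the
    monomial factor.\<close>
  also have "rk M (ground M) - rk M (cl M (Z \<union> F)) = (rk M G - rk M Z) + ?k"
  proof -
    have "rk M (Z \<union> F) + rk M (F \<inter> G) = rk M Z + rk M F"
      using Z by (intro modular_rk_Un[OF M G F]) auto
    moreover have "rk M G + rk M F = rk M (F \<inter> G) + rk M (F \<union> G)"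
      using modular_flat_rk[OF M G F] by (simp add: Int_commute Un_commute)
    moreover have "rk M (F \<union> G) \<le> rk M (ground M)" "rk M Z \<le> rk M G"
      using Z sub by (auto intro!: rk_mono[OF M])
    ultimately show ?thesis using rk_cl[OF M ZF] by simp
  qed
  also have "monom (1::int) (rk M G - rk M Z + ?k) = monom 1 (rk M G - rk M Z) * monom 1 ?k"
    by (simp add: mult_monom)
  also have "monom 1 (rk M G - rk M Z) = (\<Sum>W\<in>?A. contraction_poly (restriction M G) W)"
    unfolding sum_contraction_poly_restriction[OF M fG Z(1,3), symmetric]
    using Z by (intro sum.cong) auto
  finally show "(\<Sum>W\<in>?A. \<Sum>Y | flat M Y \<and> F \<subseteq> Y \<and> Y \<inter> G = W. contraction_poly M Y) =
      (\<Sum>W\<in>?A. contraction_poly (restriction M G) W * monom 1 ?k)"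
    by (simp add: sum_distrib_right)
qed

text \<open>Splitting off the term \<open>Y = F\<close> prepares inductions from the top, whose
  hypothesis covers the remaining terms.\<close>

lemma contraction_poly_modular_fibre:
  assumes M: "is_matroid M" and G: "modular_flat M G" and F: "flat M F"
  shows "contraction_poly M F + (\<Sum>Y | flat M Y \<and> F \<subset> Y \<and> Y \<inter> G = F \<inter> G. contraction_poly M Y) =
    contraction_poly (restriction M G) (F \<inter> G) * monom 1 (rk M (ground M) - rk M (F \<union> G))"
proof -
  let ?I = "{Y. flat M Y \<and> F \<subset> Y \<and> Y \<inter> G = F \<inter> G}"
  have "{Y. flat M Y \<and> F \<subseteq> Y \<and> Y \<inter> G = F \<inter> G} = insert F ?I" using F by auto
  moreover have "finite ?I" "F \<notin> ?I" by (auto simp: finite_flats[OF M])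
  ultimately show ?thesis
    using sum_contraction_poly_modular_fibre[OF assms] by simp
qed

text \<open>The other flats of the fibre have the same intersection with \<open>G\<close>, so by
  induction from the top their polynomials share the divisor; the fibre identity passes it on to the
  term at \<open>F\<close>.\<close>

lemma contraction_poly_modular_dvd:
  assumes M: "is_matroid M" and G: "modular_flat M G" and F: "flat M F"
  shows "contraction_poly (restriction M G) (F \<inter> G) dvd contraction_poly M F"
  using M F
proof (induction rule: flat_upward_induct)
  case (flat F)
  let ?I = "{Y. flat M Y \<and> F \<subset> Y \<and> Y \<inter> G = F \<inter> G}"
  have "contraction_poly (restriction M G) (F \<inter> G) dvd (\<Sum>Y\<in>?I. contraction_poly M Y)"
  proof (rule dvd_sum)
    fix Y assume "Y \<in> ?I"
    then show "contraction_poly (restriction M G) (F \<inter> G) dvd contraction_poly M Y"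
      using flat.IH[of Y] by simp
  qed
  moreover have "contraction_poly (restriction M G) (F \<inter> G) dvd
      contraction_poly M F + (\<Sum>Y\<in>?I. contraction_poly M Y)"
    unfolding contraction_poly_modular_fibre[OF M G flat.hyps] by (rule dvd_triv_left)
  ultimately show ?case
    using dvd_add_left_iff by blast
qed

text \<open>A flat \<open>Y \<supseteq> F\<close> with \<open>Y \<inter> E = F \<inter> E\<close> lies in \<open>G\<close>, so the fibre identities for \<open>M\<close> and for \<open>M|G\<close>
  run over the same flats.\<close>

lemma contraction_poly_modular_Un:
  assumes M: "is_matroid M" and E: "modular_flat M E" and G: "flat M G" and EG: "ground M = E \<union> G"
    and F: "flat M F" "F \<subseteq> G"
  shows "contraction_poly M F * contraction_poly (restriction M (E \<inter> G)) (F \<inter> E) =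
    contraction_poly (restriction M E) (F \<inter> E) * contraction_poly (restriction M G) F"
  using M F
proof (induction rule: flat_upward_induct)
  case (flat F)
  let ?I = "{Y. flat M Y \<and> F \<subset> Y \<and> Y \<inter> E = F \<inter> E}"
  let ?a = "contraction_poly (restriction M E) (F \<inter> E)"
  let ?c = "contraction_poly (restriction M (E \<inter> G)) (F \<inter> E)"
  let ?m = "monom (1::int) (rk M (ground M) - rk M (F \<union> E))"
  have MG: "is_matroid (restriction M G)"
    by (rule matroid_restriction[OF M flat_subset[OF G]])
  have IG: "Y \<subseteq> G" if "Y \<in> ?I" for Y
    using that EG flat_subset[of M Y] flat.prems by blast
  have mod: "modular_flat (restriction M G) (E \<inter> G)"
    by (rule modular_flat_restriction[OF M E G])
  have FE: "F \<inter> (E \<inter> G) = F \<inter> E" using flat.prems by auto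
  have I: "{Y. flat (restriction M G) Y \<and> F \<subset> Y \<and> Y \<inter> (E \<inter> G) = F \<inter> E} = ?I"
  proof (intro equalityI subsetI)
    fix Y assume "Y \<in> {Y. flat (restriction M G) Y \<and> F \<subset> Y \<and> Y \<inter> (E \<inter> G) = F \<inter> E}"
    then show "Y \<in> ?I" by (auto simp: flat_restriction[OF M G])
  next
    fix Y assume Y: "Y \<in> ?I"
    with IG[OF Y] show "Y \<in> {Y. flat (restriction M G) Y \<and> F \<subset> Y \<and> Y \<inter> (E \<inter> G) = F \<inter> E}"
      by (auto simp: flat_restriction[OF M G])
  qed
  \<comment> \<open>Three modular equations match the monomial exponents of the fibre identities in
    \<open>M\<close> and in \<open>M|G\<close>.\<close>
  have "rk M E + rk M G = rk M (E \<inter> G) + rk M (ground M)"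
    using modular_flat_rk[OF M E G] EG by simp
  moreover have "rk M E + rk M F = rk M (F \<inter> E) + rk M (F \<union> E)"
    using modular_flat_rk[OF M E flat.hyps] by (simp add: Int_commute Un_commute)
  moreover have "rk M (E \<inter> G) + rk M F = rk M (F \<inter> E) + rk M (F \<union> E \<inter> G)"
    using modular_flat_rk[OF MG mod, of F] flat.hyps flat.prems FE
    by (simp add: flat_restriction[OF M G] rk_restriction Int_commute Un_commute le_infI1 le_infI2)
  moreover have "rk M (F \<union> E) \<le> rk M (ground M)" "rk M (F \<union> E \<inter> G) \<le> rk M G"
    using flat.prems EG by (auto intro!: rk_mono[OF M])
  ultimately have k: "rk M G - rk M (F \<union> E \<inter> G) = rk M (ground M) - rk M (F \<union> E)"
    by simp
  have 1: "contraction_poly M F + (\<Sum>Y\<in>?I. contraction_poly M Y) = ?a * ?m"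
    by (rule contraction_poly_modular_fibre[OF M E flat.hyps])
  have 2: "contraction_poly (restriction M G) F + (\<Sum>Y\<in>?I. contraction_poly (restriction M G) Y) = ?c * ?m"
  proof -
    have "rk (restriction M G) G - rk (restriction M G) (F \<union> E \<inter> G) = rk M (ground M) - rk M (F \<union> E)"
      using flat.prems by (simp add: rk_restriction k)
    moreover have "flat (restriction M G) F"
      using flat.hyps flat.prems by (simp add: flat_restriction[OF M G])
    ultimately show ?thesis
      using contraction_poly_modular_fibre[OF MG mod, of F]
      unfolding FE I ground_restriction restriction_restriction[OF Int_lower2] by simp
  qed
  \<comment> \<open>All \<open>Y\<close> in the fibre meet \<open>E\<close> in
    \<open>F \<inter> E\<close>, so the induction hypothesis has the same factors \<open>?a\<close>
    and \<open>?c\<close> for each and can be summed.\<close>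
  have "(\<Sum>Y\<in>?I. contraction_poly M Y) * ?c = (\<Sum>Y\<in>?I. ?a * contraction_poly (restriction M G) Y)"
    unfolding sum_distrib_right
  proof (rule sum.cong)
    fix Y assume Y: "Y \<in> ?I"
    then show "contraction_poly M Y * ?c = ?a * contraction_poly (restriction M G) Y"
      using flat.IH[of Y] IG[OF Y] by simp
  qed simp
  then have 3: "(\<Sum>Y\<in>?I. contraction_poly M Y) * ?c = ?a * (\<Sum>Y\<in>?I. contraction_poly (restriction M G) Y)"
    by (simp add: sum_distrib_left)
  have "contraction_poly M F * ?c = (?a * ?m - (\<Sum>Y\<in>?I. contraction_poly M Y)) * ?c"
    using 1 by (simp add: eq_diff_eq)
  also have "\<dots> = ?a * (?c * ?m - (\<Sum>Y\<in>?I. contraction_poly (restriction M G) Y))"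
    using 3 by (simp add: algebra_simps)
  also have "\<dots> = ?a * contraction_poly (restriction M G) F"
    using 2 by (simp add: eq_diff_eq)
  finally show ?case .
qed

section \<open>Projection to a modular coatom\<close>

lemma simple_imp_matroid: "simple_matroid M \<Longrightarrow> is_matroid M"
  by (simp add: simple_matroid_def)

context
  fixes M :: "'a matroid"
  assumes simple: "simple_matroid M"
begin

lemma rk_pair: "e \<in> ground M \<Longrightarrow> f \<in> ground M \<Longrightarrow> rk M {e, f} = card {e, f}"
  using simple rk_le_card[of M "{e, f}"] card_le_rk[of M "{e, f}" "{e, f}"]
  by (simp add: simple_matroid_def)

lemma rk_singleton: "e \<in> ground M \<Longrightarrow> rk M {e} = 1"
  using rk_pair[of e e] by simp

lemma flat_empty: "flat M {}"
  by (rule flatI[OF simple_imp_matroid[OF simple]])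
    (simp_all add: rk_singleton rk_empty[OF simple_imp_matroid[OF simple]])

lemma flat_singleton: "e \<in> ground M \<Longrightarrow> flat M {e}"
  by (rule flatI[OF simple_imp_matroid[OF simple]]) (simp_all add: rk_singleton rk_pair)

end

context
  fixes M :: "'a matroid" and H X :: "'a set" and c :: 'a
  assumes simple: "simple_matroid M" and H: "modular_flat M H" and coatom: "coatom M H"
    and c: "c \<in> ground M" "c \<notin> H"
begin

private lemmas M = simple_imp_matroid[OF simple]

lemma coatom_complement:
  "flat M {c}" "{c} \<inter> H = {}" "rk M H + rk M {c} = rk M (ground M)"
  using c flat_singleton[OF simple] rk_singleton[OF simple] coatom by (auto simp: coatom_def)

text \<open>A cover of the projection by two proper flats is pulled back: the cones over them with
  apex \<open>c\<close>, cut down to \<open>X\<close>, would cover \<open>X\<close>. The apex may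
  lie in \<open>X\<close>; the projection is then \<open>X \<inter> H\<close>.\<close>

lemma round_flat_projection:
  assumes X: "round_flat M X"
  shows "round_flat M (cl M (insert c X) \<inter> H)"
proof -
  note comp = M H coatom_complement
  have fX: "flat M X" using X by (simp add: round_flat_def)
  have fH: "flat M H" using H by (simp add: modular_flat_def)
  let ?V = "cl M (insert c X)"
  have cX: "insert c X \<subseteq> ground M" using c flat_subset[OF fX] by simp
  have V: "flat M ?V" "insert c X \<subseteq> ?V"
    using flat_cl[OF M cX] subset_cl[OF M cX] by auto
  let ?U = "?V \<inter> H"
  show ?thesis
    unfolding round_flat_iff[OF M]
  proof (intro conjI notI)
    show "flat M ?U" by (rule flat_Int[OF M V(1) fH])
    assume "\<exists>F G. flat M F \<and> flat M G \<and> F \<noteq> ?U \<and> G \<noteq> ?U \<and> F \<union> G = ?U"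
    then obtain F G where FG: "flat M F" "flat M G" "F \<noteq> ?U" "G \<noteq> ?U" "F \<union> G = ?U"
      by blast
    let ?P = "\<lambda>F. cl M (insert c F) \<inter> X"
    have cF: "insert c F \<subseteq> ground M" "insert c F \<subseteq> cl M (insert c F)" "flat M (cl M (insert c F))"
      if "flat M F" for F
    proof -
      show *: "insert c F \<subseteq> ground M" using c flat_subset[OF that] by simp
      show "insert c F \<subseteq> cl M (insert c F)" "flat M (cl M (insert c F))"
        by (rule subset_cl[OF M *]) (rule flat_cl[OF M *])
    qed
    \<comment> \<open>If the cone over \<open>F\<close> contained \<open>X\<close>, it would contain
      \<open>?V\<close>; intersecting with \<open>H\<close>, which recovers \<open>F\<close> from
      its cone, would give \<open>?U \<subseteq> F\<close>.\<close>
    have proper: "?P F \<noteq> X" if F: "flat M F" "F \<subseteq> ?U" "F \<noteq> ?U" for F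
    proof
      assume "?P F = X"
      then have "insert c X \<subseteq> cl M (insert c F)" using cF[OF F(1)] by blast
      then have "?V \<subseteq> cl M (insert c F)" by (rule cl_subset_flat[OF M cF(3)[OF F(1)]])
      moreover have "cl M (insert c F) \<inter> H = F"
        using complement_modular_law[OF comp F(1)] F(2) by simp
      ultimately show False using F by blast
    qed
    \<comment> \<open>The line through \<open>c\<close> and \<open>p \<in> X\<close> meets \<open>H\<close> in at most one point, which lies in \<open>F\<close> or in \<open>G\<close>.\<close>
    have "X \<subseteq> ?P F \<union> ?P G"
    proof
      fix p assume p: "p \<in> X"
      let ?Z = "cl M {c, p}"
      have cp: "{c, p} \<subseteq> ground M" using p cX by auto
      have Z: "flat M ?Z" "{c, p} \<subseteq> ?Z"
        by (rule flat_cl[OF M cp]) (rule subset_cl[OF M cp])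
      \<comment> \<open>Only an upper bound holds: for \<open>p = c\<close> the rank is 1 and
        \<open>?Z \<inter> H\<close> is empty.\<close>
      have "rk M ?Z \<le> 2"
        using rk_cl[OF M cp] rk_pair[OF simple, of c p] cp card_insert_le_m1[of 2 "{p}" c] by simp
      then have rZ: "rk M (?Z \<inter> H) \<le> 1"
        using rk_Int_complement[OF comp Z(1)] Z(2) rk_singleton[OF simple c(1)] by simp
      have ZH: "flat M (?Z \<inter> H)" by (rule flat_Int[OF M Z(1) fH])
      have "?Z \<subseteq> ?V" using p V by (intro cl_subset_flat[OF M]) auto
      then have ZU: "?Z \<inter> H \<subseteq> F \<union> G" using FG by blast
      have "?Z \<inter> H \<subseteq> F \<or> ?Z \<inter> H \<subseteq> G"
      proof (cases "?Z \<inter> H = {}")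
        case False
        then obtain q where q: "q \<in> ?Z \<inter> H" by blast
        then have "q \<in> ground M" using flat_subset[OF fH] by blast
        then have "1 = rk M {q}" using rk_singleton[OF simple] by simp
        have "?Z \<inter> H \<subseteq> F" if "flat M F" "q \<in> F" for F
        proof -
          have "rk M (?Z \<inter> H) \<le> rk M (F \<inter> (?Z \<inter> H))"
            using rZ \<open>1 = rk M {q}\<close> rk_mono[OF M, of "{q}" "F \<inter> (?Z \<inter> H)"] q that by simp
          then have "?Z \<inter> H \<subseteq> F \<inter> (?Z \<inter> H)"
            by (rule flat_rk_le_subset[OF M flat_Int[OF M that(1) ZH] Int_lower2 flat_subset[OF ZH]])
          then show ?thesis by blast
        qed
        moreover have "q \<in> F \<or> q \<in> G" using q ZU by blast
        ultimately show ?thesis using FG(1,2) by blast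
      qed simp
      moreover have "p \<in> ?P F" if F: "flat M F" "?Z \<inter> H \<subseteq> F" for F
      proof -
        have "?Z = cl M (?Z \<inter> H \<union> {c})"
          using cl_Int_Un_complement[OF comp Z(1)] Z(2) by simp
        also have "\<dots> \<subseteq> cl M (insert c F)"
          using F cF(1)[OF F(1)] by (intro cl_mono[OF M]) auto
        finally show ?thesis using p Z(2) by auto
      qed
      ultimately show "p \<in> ?P F \<union> ?P G" using FG by blast
    qed
    then have "?P F \<union> ?P G = X" by blast
    moreover have "flat M (?P F)" "flat M (?P G)"
      using FG cF(3) flat_Int[OF M _ fX] by auto
    moreover have "?P F \<noteq> X" "?P G \<noteq> X"
      using proper[OF FG(1)] proper[OF FG(2)] FG(3,4,5) by blast+
    ultimately show False
      using X unfolding round_flat_iff[OF M] by blast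
  qed
qed

text \<open>Compare cones with apex \<open>c\<close>: \<open>?V\<close> over \<open>?U\<close> and
  \<open>?Y\<close> over a flat \<open>Y\<close> of \<open>H\<close>. Modularity of \<open>X\<close>
  against \<open>?Y\<close> and against the intersection of the two cones gives the required
  equation, since cutting a flat through \<open>c\<close> by \<open>H\<close> lowers its rank by
  one.\<close>

lemma
  assumes X: "modular_flat M X" and cX: "c \<notin> X"
  shows rk_projection: "rk M (cl M (insert c X) \<inter> H) = rk M X"
    and modular_flat_projection: "modular_flat (restriction M H) (cl M (insert c X) \<inter> H)"
proof -
  note comp = M H coatom_complement
  have fX: "flat M X" using X by (simp add: modular_flat_def)
  have fH: "flat M H" using H by (simp add: modular_flat_def)
  have MH: "is_matroid (restriction M H)"
    by (rule matroid_restriction[OF M flat_subset[OF fH]])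
  let ?V = "cl M (insert c X)"
  let ?U = "?V \<inter> H"
  have cXg: "insert c X \<subseteq> ground M" using c flat_subset[OF fX] by simp
  have V: "flat M ?V" "insert c X \<subseteq> ?V" "rk M ?V = rk M X + 1"
    using flat_cl[OF M cXg] subset_cl[OF M cXg] rk_cl[OF M cXg] rk_insert_flat[OF M fX c(1) cX] by auto
  have rc: "rk M {c} = 1" by (rule rk_singleton[OF simple c(1)])
  have fU: "flat M ?U" by (rule flat_Int[OF M V(1) fH])
  show rU: "rk M ?U = rk M X"
    using rk_Int_complement[OF comp V(1)] V rc by simp
  show "modular_flat (restriction M H) ?U"
    unfolding modular_flat_iff[OF MH] flat_restriction[OF M fH]
  proof (intro conjI allI impI)
    fix Y assume "flat M Y \<and> Y \<subseteq> H"
    then have Y: "flat M Y" "Y \<subseteq> H" by auto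
    let ?Y = "cl M (insert c Y)"
    have cY: "insert c Y \<subseteq> ground M" using c flat_subset[OF Y(1)] by simp
    have Yc: "flat M ?Y" "insert c Y \<subseteq> ?Y" "rk M ?Y = rk M Y + 1" "?Y \<inter> H = Y"
      using flat_cl[OF M cY] subset_cl[OF M cY] rk_cl[OF M cY] Y c complement_modular_law[OF comp Y]
        rk_insert_flat[OF M Y(1) c(1)] by auto
    let ?W = "?V \<inter> ?Y"
    have W: "flat M ?W" by (rule flat_Int[OF M V(1) Yc(1)])
    have "?W \<inter> H = ?U \<inter> Y" using Yc(4) by blast
    then have 1: "rk M ?W = rk M (?U \<inter> Y) + 1"
      using rk_Int_complement[OF comp W] V Yc rc by simp
    have "X \<inter> ?W = X \<inter> ?Y" using V by blast
    \<comment> \<open>\<open>?W\<close> contains \<open>c\<close> and lies in \<open>?V\<close>, so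
      \<open>X \<union> ?W\<close> spans \<open>?V\<close>.\<close>
    moreover have "rk M (X \<union> ?W) = rk M X + 1"
    proof (rule antisym)
      show "rk M (X \<union> ?W) \<le> rk M X + 1"
        unfolding V(3)[symmetric] using V by (intro rk_mono[OF M]) auto
      have "rk M (insert c X) \<le> rk M (X \<union> ?W)"
        using V Yc by (intro rk_mono[OF M]) auto
      then show "rk M X + 1 \<le> rk M (X \<union> ?W)"
        using rk_insert_flat[OF M fX c(1) cX] by simp
    qed
    ultimately have 2: "rk M ?W = rk M (X \<inter> ?Y) + 1"
      using modular_flat_rk[OF M X W] by simp
    have 3: "rk M X + rk M Y + 1 = rk M (X \<inter> ?Y) + rk M (X \<union> insert c Y)"
      using modular_flat_rk[OF M X Yc(1)] Yc(3) rk_Un_cl_right[OF M flat_subset[OF fX] cY] by simp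
    have UY: "?U \<union> Y \<subseteq> ground M" using flat_subset[OF fU] cY by auto
    let ?T = "cl M (?U \<union> Y)"
    have T: "flat M ?T" "?U \<union> Y \<subseteq> ?T" "rk M ?T = rk M (?U \<union> Y)" "?T \<subseteq> H"
      using flat_cl[OF M UY] subset_cl[OF M UY] rk_cl[OF M UY] Y cl_subset_flat[OF M fH] by auto
    \<comment> \<open>Both sets span the join of \<open>X\<close>, \<open>Y\<close> and
      \<open>c\<close>, because \<open>X\<close> and \<open>?U\<close> have the same cone
      \<open>?V\<close>.\<close>
    have "rk M (X \<union> insert c Y) = rk M (?T \<union> {c})"
    proof (rule antisym)
      have Tc: "?T \<union> {c} \<subseteq> ground M" using T(4) flat_subset[OF fH] c by auto
      have fTc: "flat M (cl M (?T \<union> {c}))" "?T \<union> {c} \<subseteq> cl M (?T \<union> {c})"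
        by (rule flat_cl[OF M Tc]) (rule subset_cl[OF M Tc])
      have "?V = cl M (?U \<union> {c})"
        using cl_Int_Un_complement[OF comp V(1)] V(2) by simp
      also have "\<dots> \<subseteq> cl M (?T \<union> {c})"
        using T Tc by (intro cl_mono[OF M]) auto
      finally have "X \<union> insert c Y \<subseteq> cl M (?T \<union> {c})" using V T fTc by blast
      then show "rk M (X \<union> insert c Y) \<le> rk M (?T \<union> {c})"
        using rk_mono[OF M] rk_cl[OF M Tc] by metis
      have Xc: "X \<union> insert c Y \<subseteq> ground M" using flat_subset[OF fX] cY by auto
      have fXc: "flat M (cl M (X \<union> insert c Y))" "X \<union> insert c Y \<subseteq> cl M (X \<union> insert c Y)"
        by (rule flat_cl[OF M Xc]) (rule subset_cl[OF M Xc])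
      have "?V \<subseteq> cl M (X \<union> insert c Y)" using Xc by (intro cl_mono[OF M]) auto
      then have "?T \<subseteq> cl M (X \<union> insert c Y)"
        using fXc by (intro cl_subset_flat[OF M]) auto
      then have "?T \<union> {c} \<subseteq> cl M (X \<union> insert c Y)" using fXc by auto
      then show "rk M (?T \<union> {c}) \<le> rk M (X \<union> insert c Y)"
        using rk_mono[OF M] rk_cl[OF M Xc] by metis
    qed
    also have "\<dots> = rk M (?U \<union> Y) + 1"
      using rk_Un_complement[OF comp T(1,4)] T(3) rc by simp
    finally have 4: "rk M (X \<union> insert c Y) = rk M (?U \<union> Y) + 1" .
    have "rk M ?U + rk M Y = rk M (?U \<inter> Y) + rk M (?U \<union> Y)"
      using rU 1 2 3 4 by simp
    moreover have "?U \<subseteq> H" "?U \<inter> Y \<subseteq> H" "?U \<union> Y \<subseteq> H" using Y by auto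
    ultimately show "rk (restriction M H) ?U + rk (restriction M H) Y =
        rk (restriction M H) (?U \<inter> Y) + rk (restriction M H) (?U \<union> Y)"
      using Y(2) by (simp only: rk_restriction)
  qed (use fU in auto)
qed

end

section \<open>Chains avoiding a round modular flat\<close>

text \<open>The conditions of a divisional flag up to rank \<open>k\<close>, with disjointness from
  \<open>X\<close> added. The length is a parameter so that chains can be concatenated; only the
  values up to \<open>k\<close> matter.\<close>

definition avoiding_chain :: "'a matroid \<Rightarrow> 'a set \<Rightarrow> nat \<Rightarrow> (nat \<Rightarrow> 'a set) \<Rightarrow> bool" where
  "avoiding_chain M X k Y \<longleftrightarrow>
     Y 0 = {} \<and>
     (\<forall>i\<le>k. flat M (Y i) \<and> rk M (Y i) = i \<and> Y i \<inter> X = {}) \<and>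
     (\<forall>i<k. Y i \<subseteq> Y (Suc i) \<and> contraction_poly M (Y (Suc i)) dvd contraction_poly M (Y i))"

text \<open>\<open>Y k\<close> is a complement of \<open>G\<close>, so \<open>Z\<close> is lifted to
  flats above \<open>Y k\<close> by joining with \<open>Y k\<close>, which preserves the
  polynomials. Avoiding the projection of \<open>X\<close> from \<open>Y k\<close> to
  \<open>G\<close> is what makes the lifted flats avoid \<open>X\<close>.\<close>

lemma avoiding_chain_append:
  assumes M: "is_matroid M" and G: "modular_flat M G" and X: "X \<subseteq> ground M"
    and Y: "avoiding_chain M X k Y" and disj: "Y k \<inter> G = {}" and rank: "rk M G + k = rk M (ground M)"
    and Z: "avoiding_chain (restriction M G) (cl M (X \<union> Y k) \<inter> G) m Z"
  shows "\<exists>W. avoiding_chain M X (k + m) W"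
proof -
  have fG: "flat M G" using G by (simp add: modular_flat_def)
  have Yk: "flat M (Y k)" "rk M (Y k) = k" "Y k \<inter> X = {}"
    using Y by (auto simp: avoiding_chain_def)
  have "rk M G + rk M (Y k) = rk M (ground M)" using rank Yk by simp
  note comp = M G Yk(1) disj this
  have Zj: "flat M (Z j)" "Z j \<subseteq> G" "rk M (Z j) = j" "Z j \<inter> (cl M (X \<union> Y k) \<inter> G) = {}" if "j \<le> m" for j
  proof -
    have "flat (restriction M G) (Z j) \<and> rk (restriction M G) (Z j) = j
        \<and> Z j \<inter> (cl M (X \<union> Y k) \<inter> G) = {}"
      using Z that by (auto simp: avoiding_chain_def)
    then show "flat M (Z j)" "Z j \<subseteq> G" "rk M (Z j) = j" "Z j \<inter> (cl M (X \<union> Y k) \<inter> G) = {}"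
      by (auto simp: flat_restriction[OF M fG] rk_restriction)
  qed
  define V where "V j = cl M (Z j \<union> Y k)" for j
  have sub: "Z j \<union> Y k \<subseteq> ground M" if "j \<le> m" for j
    using Zj(1)[OF that] Yk(1) flat_subset by blast
  have V0: "V 0 = Y k"
    using Z cl_flat[OF M Yk(1)] by (simp add: V_def avoiding_chain_def)
  have XY: "X \<union> Y k \<subseteq> ground M" using X flat_subset[OF Yk(1)] by simp
  have V: "flat M (V j) \<and> rk M (V j) = k + j \<and> V j \<inter> X = {}" if j: "j \<le> m" for j
  proof (intro conjI)
    show fV: "flat M (V j)"
      unfolding V_def by (rule flat_cl[OF M sub[OF j]])
    show "rk M (V j) = k + j"
      using rk_cl[OF M sub[OF j]] rk_Un_complement[OF comp Zj(1,2)[OF j]] Zj(3)[OF j] Yk(2)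
      by (simp add: V_def)
    \<comment> \<open>This flat contains \<open>Y k\<close> and does not meet \<open>G\<close>, so
      it equals \<open>Y k\<close>, which avoids \<open>X\<close>.\<close>
    let ?T = "V j \<inter> cl M (X \<union> Y k)"
    have T: "flat M ?T" by (rule flat_Int[OF M fV flat_cl[OF M XY]])
    have YT: "Y k \<subseteq> ?T"
      using subset_cl[OF M sub[OF j]] subset_cl[OF M XY] by (auto simp: V_def)
    have "V j \<inter> G = Z j"
      unfolding V_def by (rule complement_modular_law[OF comp Zj(1,2)[OF j]])
    then have "?T \<inter> G = {}" using Zj(4)[OF j] by blast
    then have "?T = Y k"
      using cl_Int_Un_complement[OF comp T YT] cl_flat[OF M Yk(1)] by simp
    then show "V j \<inter> X = {}"
      using Yk(3) subset_cl[OF M XY] by blast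
  qed
  have Vstep: "V j \<subseteq> V (Suc j) \<and> contraction_poly M (V (Suc j)) dvd contraction_poly M (V j)"
    if j: "j < m" for j
  proof
    have j': "j \<le> m" "Suc j \<le> m" using j by auto
    have Zs: "Z j \<subseteq> Z (Suc j)"
      "contraction_poly (restriction M G) (Z (Suc j)) dvd contraction_poly (restriction M G) (Z j)"
      using Z j by (auto simp: avoiding_chain_def)
    show "V j \<subseteq> V (Suc j)"
      unfolding V_def using Zs sub[OF j'(2)] by (intro cl_mono[OF M]) auto
    show "contraction_poly M (V (Suc j)) dvd contraction_poly M (V j)"
      using Zs(2) contraction_poly_complement[OF comp Zj(1,2)[OF j'(1)]]
        contraction_poly_complement[OF comp Zj(1,2)[OF j'(2)]]
      by (simp add: V_def)
  qed
  \<comment> \<open>The two pieces overlap at index \<open>k\<close>: \<open>Z 0 = {}\<close> gives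
    \<open>V 0 = Y k\<close>.\<close>
  define W where "W i = (if i \<le> k then Y i else V (i - k))" for i
  have WV: "W i = V (i - k)" if "k \<le> i" for i
    using that V0 by (auto simp: W_def)
  have "avoiding_chain M X (k + m) W"
    unfolding avoiding_chain_def
  proof (intro conjI allI impI)
    show "W 0 = {}" using Y by (simp add: W_def avoiding_chain_def)
  next
    fix i assume i: "i \<le> k + m"
    have "flat M (W i) \<and> rk M (W i) = i \<and> W i \<inter> X = {}"
    proof (cases "i \<le> k")
      case True
      then show ?thesis using Y by (simp add: W_def avoiding_chain_def)
    next
      case False
      then show ?thesis using V[of "i - k"] i by (simp add: WV)
    qed
    then show "flat M (W i)" "rk M (W i) = i" "W i \<inter> X = {}" by auto
  next
    fix i assume i: "i < k + m"
    have "W i \<subseteq> W (Suc i) \<and> contraction_poly M (W (Suc i)) dvd contraction_poly M (W i)"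
    proof (cases "i < k")
      case True
      then show ?thesis using Y by (simp add: W_def avoiding_chain_def)
    next
      case False
      then show ?thesis using Vstep[of "i - k"] i by (simp add: WV Suc_diff_le)
    qed
    then show "W i \<subseteq> W (Suc i)" "contraction_poly M (W (Suc i)) dvd contraction_poly M (W i)"
      by auto
  qed
  then show ?thesis by blast
qed

text \<open>Every \<open>Y i\<close> is disjoint from \<open>E\<close>, so the two outer factors in
  \<open>contraction_poly_modular_Un\<close> are constant along the chain. Divisibility passes from
  \<open>M|G\<close> to \<open>M\<close> by cancelling the nonzero factor \<open>?c\<close>.\<close>

lemma avoiding_chain_of_restriction:
  assumes M: "is_matroid M" and E: "modular_flat M E" and G: "flat M G" and EG: "ground M = E \<union> G"
    and Y: "avoiding_chain (restriction M G) (E \<inter> G) k Y"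
  shows "avoiding_chain M E k Y"
proof -
  have fE: "flat M E" using E by (simp add: modular_flat_def)
  have Yi: "flat M (Y i)" "Y i \<subseteq> G" "rk M (Y i) = i" "Y i \<inter> E = {}" if "i \<le> k" for i
  proof -
    have "flat (restriction M G) (Y i) \<and> rk (restriction M G) (Y i) = i \<and> Y i \<inter> (E \<inter> G) = {}"
      using Y that by (auto simp: avoiding_chain_def)
    then show "flat M (Y i)" "Y i \<subseteq> G" "rk M (Y i) = i" "Y i \<inter> E = {}"
      by (auto simp: flat_restriction[OF M G] rk_restriction)
  qed
  have Y0: "Y 0 = {}" using Y by (simp add: avoiding_chain_def)
  let ?c = "contraction_poly (restriction M (E \<inter> G)) {}"
  let ?a = "contraction_poly (restriction M E) {}"
  have fEG: "flat M (E \<inter> G)" by (rule flat_Int[OF M fE G])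
  have "flat (restriction M (E \<inter> G)) {}"
    using Yi(1)[of 0] Y0 by (simp add: flat_restriction[OF M fEG])
  then have c: "?c \<noteq> 0"
    by (rule contraction_poly_nonzero[OF matroid_restriction[OF M flat_subset[OF fEG]]])
  have eq: "contraction_poly M (Y i) * ?c = ?a * contraction_poly (restriction M G) (Y i)" if "i \<le> k" for i
    using contraction_poly_modular_Un[OF M E G EG Yi(1,2)[OF that]] Yi(4)[OF that] by simp
  have dvd: "contraction_poly M (Y (Suc i)) dvd contraction_poly M (Y i)" if i: "i < k" for i
  proof -
    have "contraction_poly (restriction M G) (Y (Suc i)) dvd contraction_poly (restriction M G) (Y i)"
      using Y i by (auto simp: avoiding_chain_def)
    then have "contraction_poly M (Y (Suc i)) * ?c dvd contraction_poly M (Y i) * ?c"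
      using eq[of i] eq[of "Suc i"] i by (simp add: mult_dvd_mono)
    then show ?thesis using c by (simp only: dvd_mult_cancel_right) simp
  qed
  show ?thesis
    using Y Yi dvd by (simp add: avoiding_chain_def)
qed

text \<open>\<open>{c}\<close> is a complement of \<open>H\<close>, so contracting \<open>c\<close>
  gives the characteristic polynomial of \<open>M|H\<close>, which divides that of \<open>M\<close>
  by modularity of \<open>H\<close>.\<close>

lemma avoiding_chain_modular_coatom:
  assumes simple: "simple_matroid M" and H: "modular_flat M H" and coatom: "coatom M H"
    and c: "c \<in> ground M" "c \<notin> H" "c \<notin> X"
  shows "avoiding_chain M X 1 (\<lambda>i. if i = 0 then {} else {c})"
proof -
  note M = simple_imp_matroid[OF simple]
  have fc: "flat M {c}" "flat M {}" "rk M {c} = 1"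
    using flat_singleton[OF simple c(1)] flat_empty[OF simple] rk_singleton[OF simple c(1)] by auto
  note comp = M H coatom_complement[OF simple H coatom c(1,2)]
  have "contraction_poly (restriction M H) {} = contraction_poly M {c}"
    using contraction_poly_complement[OF comp fc(2)] cl_flat[OF M fc(1)] by simp
  moreover have "contraction_poly (restriction M H) {} dvd contraction_poly M {}"
    using contraction_poly_modular_dvd[OF M H fc(2)] by simp
  ultimately show ?thesis
    using fc c rk_empty[OF M] by (auto simp: avoiding_chain_def le_Suc_eq)
qed

lemma avoiding_chain_modular_join:
  assumes simple: "simple_matroid M" and join: "modular_join M E F" and round: "round_flat M (E \<inter> F)"
    and E: "\<And>X. round_flat (restriction M E) X \<Longrightarrow> modular_flat (restriction M E) X \<Longrightarrow>
      \<exists>Y. avoiding_chain (restriction M E) X (rk M E - rk M X) Y"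
    and F: "\<And>X. round_flat (restriction M F) X \<Longrightarrow> modular_flat (restriction M F) X \<Longrightarrow>
      \<exists>Y. avoiding_chain (restriction M F) X (rk M F - rk M X) Y"
    and X: "round_flat M X" "modular_flat M X" "X \<subseteq> E"
  shows "\<exists>Y. avoiding_chain M X (rk M (ground M) - rk M X) Y"
proof -
  note M = simple_imp_matroid[OF simple]
  have mod: "modular_flat M E" "modular_flat M F" and EF: "ground M = E \<union> F"
    using join by (auto simp: modular_join_def)
  then have fl: "flat M E" "flat M F" "flat M X"
    using X by (auto simp: modular_flat_def)
  \<comment> \<open>Roundness of the intersection allows the hypothesis on \<open>F\<close> to be
    used with \<open>E \<inter> F\<close> as the flat to avoid.\<close>
  have "round_flat (restriction M F) (E \<inter> F)"
    using round_flat_restriction[OF M fl(2) Int_lower2] round by simp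
  then obtain Y where "avoiding_chain (restriction M F) (E \<inter> F) (rk M F - rk M (E \<inter> F)) Y"
    using F modular_flat_restriction[OF M mod(1) fl(2)] by blast
  then have Y: "avoiding_chain M E (rk M F - rk M (E \<inter> F)) Y"
    by (rule avoiding_chain_of_restriction[OF M mod(1) fl(2) EF])
  let ?k = "rk M F - rk M (E \<inter> F)"
  have Yk: "Y ?k \<inter> E = {}" "flat M (Y ?k)" using Y by (auto simp: avoiding_chain_def)
  have YX: "avoiding_chain M X ?k Y"
    using Y X(3) by (auto simp: avoiding_chain_def)
  have "rk M (E \<inter> F) \<le> rk M F" by (intro rk_mono[OF M]) auto
  then have rank: "rk M E + ?k = rk M (ground M)"
    using modular_flat_rk[OF M mod(1) fl(2)] EF by simp
  have "modular_flat (restriction M E) X"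
    using modular_flat_restriction[OF M X(2) fl(1)] X(3) by (simp add: Int_absorb2)
  then obtain Z where Z: "avoiding_chain (restriction M E) X (rk M E - rk M X) Z"
    using E X(1) round_flat_restriction[OF M fl(1) X(3)] by blast
  \<comment> \<open>By the modular law \<open>X\<close> is its own projection from
    \<open>Y ?k\<close> to \<open>E\<close>, so a chain of \<open>M|E\<close> avoiding
    \<open>X\<close> can be appended.\<close>
  have "cl M (X \<union> Y ?k) \<inter> E = X"
    using Yk X(3) by (intro modular_law[OF M mod(1) _ fl(3)]) auto
  then have "\<exists>W. avoiding_chain M X (?k + (rk M E - rk M X)) W"
    using avoiding_chain_append[OF M mod(1) flat_subset[OF fl(3)] YX Yk(1) rank] Z by simp
  moreover have "rk M X \<le> rk M E" using X(3) by (rule rk_mono[OF M])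
  then have "?k + (rk M E - rk M X) = rk M (ground M) - rk M X" using rank by simp
  ultimately show ?thesis by simp
qed

lemma modularly_extended_imp_avoiding_chain:
  assumes "modularly_extended M" "round_flat M X" "modular_flat M X"
  shows "\<exists>Y. avoiding_chain M X (rk M (ground M) - rk M X) Y"
  using assms
proof (induction arbitrary: X rule: modularly_extended.induct)
  case (empty M)
  note M = simple_imp_matroid[OF empty.hyps(1)]
  have "avoiding_chain M X 0 (\<lambda>_. {})"
    using flat_empty[OF empty.hyps(1)] rk_empty[OF M] by (simp add: avoiding_chain_def)
  then show ?case using empty.hyps(2) rk_empty[OF M] by auto
next
  case (coatom M H)
  note simple = coatom.hyps(1) and H = coatom.hyps(3) and cH = coatom.hyps(2)
  note M = simple_imp_matroid[OF simple]
  have fl: "flat M H" "flat M X"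
    using H coatom.prems by (auto simp: modular_flat_def)
  have rH: "rk M H + 1 = rk M (ground M)" using cH by (simp add: coatom_def)
  show ?case
  proof (cases "ground M = X \<union> H")
    case True
    have "\<not> X \<subseteq> H"
    proof
      assume "X \<subseteq> H"
      then have "ground M = H" using True by auto
      then show False using rH by simp
    qed
    then obtain c where c: "c \<in> X" "c \<notin> H" by blast
    then have "c \<in> ground M" using True by auto
    \<comment> \<open>Since \<open>c \<in> X\<close>, the projection of \<open>X\<close> from
      \<open>c\<close> is \<open>X \<inter> H\<close>.\<close>
    then have "round_flat M (X \<inter> H)"
      using round_flat_projection[OF simple H cH _ c(2) coatom.prems(1)] c(1) cl_flat[OF M fl(2)]
      by (simp add: insert_absorb)
    then have "round_flat (restriction M H) (X \<inter> H)"
      using round_flat_restriction[OF M fl(1) Int_lower2] by simp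
    then obtain Y where "avoiding_chain (restriction M H) (X \<inter> H)
        (rk (restriction M H) (ground (restriction M H)) - rk (restriction M H) (X \<inter> H)) Y"
      using coatom.IH modular_flat_restriction[OF M coatom.prems(2) fl(1)] by blast
    then have "avoiding_chain (restriction M H) (X \<inter> H) (rk M H - rk M (X \<inter> H)) Y"
      by (simp add: rk_restriction)
    then have "avoiding_chain M X (rk M H - rk M (X \<inter> H)) Y"
      by (rule avoiding_chain_of_restriction[OF M coatom.prems(2) fl(1) True])
    moreover have "rk M H - rk M (X \<inter> H) = rk M (ground M) - rk M X"
      using modular_flat_rk[OF M coatom.prems(2) fl(1)] True by simp
    ultimately show ?thesis by auto
  next
    case False
    then obtain c where c: "c \<in> ground M" "c \<notin> H" "c \<notin> X"
      using flat_subset[OF fl(1)] flat_subset[OF fl(2)] by blast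
    let ?U = "cl M (insert c X) \<inter> H"
    let ?Y = "\<lambda>i::nat. if i = 0 then {} else {c}"
    have "round_flat (restriction M H) ?U"
      using round_flat_projection[OF simple H cH c(1,2) coatom.prems(1)]
        round_flat_restriction[OF M fl(1) Int_lower2] by simp
    then obtain Z where "avoiding_chain (restriction M H) ?U
        (rk (restriction M H) (ground (restriction M H)) - rk (restriction M H) ?U) Z"
      using coatom.IH modular_flat_projection[OF simple H cH c(1,2) coatom.prems(2) c(3)] by blast
    then have Z: "avoiding_chain (restriction M H) (cl M (X \<union> ?Y 1) \<inter> H) (rk M H - rk M X) Z"
      using rk_projection[OF simple H cH c(1,2) coatom.prems(2) c(3)] by (simp add: rk_restriction)
    have "\<exists>W. avoiding_chain M X (1 + (rk M H - rk M X)) W"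
      using avoiding_chain_append[OF M H flat_subset[OF fl(2)]
          avoiding_chain_modular_coatom[OF simple H cH c] _ rH Z] c by simp
    moreover have "rk M X \<le> rk M H"
      using rk_projection[OF simple H cH c(1,2) coatom.prems(2) c(3)] rk_mono[OF M, of ?U H] by simp
    then have "1 + (rk M H - rk M X) = rk M (ground M) - rk M X" using rH by simp
    ultimately show ?thesis by simp
  qed
next
  case (join M E F)
  note M = simple_imp_matroid[OF join.hyps(1)]
  have mod: "modular_flat M E" "modular_flat M F" and EF: "ground M = E \<union> F"
    using join.hyps(2) by (auto simp: modular_join_def)
  then have fl: "flat M E" "flat M F" "flat M X"
    using join.prems by (auto simp: modular_flat_def)
  have IH: "\<exists>Y. avoiding_chain (restriction M G) X (rk M G - rk M X) Y"
    if "round_flat (restriction M G) X" "modular_flat (restriction M G) X" "G = E \<or> G = F" for G X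
  proof -
    have "X \<subseteq> G" using that(1) flat_subset[of "restriction M G" X] by (simp add: round_flat_def)
    then show ?thesis
      using that join.IH(1)[of X] join.IH(2)[of X] by (auto simp: rk_restriction)
  qed
  \<comment> \<open>\<open>X\<close> is the union of two flats, so roundness makes one of them all
    of \<open>X\<close> and places \<open>X\<close> in one side of the join.\<close>
  have "(X \<inter> E) \<union> (X \<inter> F) = X" using flat_subset[OF fl(3)] EF by blast
  moreover have "flat M (X \<inter> E)" "flat M (X \<inter> F)" using fl flat_Int[OF M] by auto
  ultimately have "X \<inter> E = X \<or> X \<inter> F = X"
    using join.prems(1) unfolding round_flat_iff[OF M] by blast
  then show ?case
  proof
    assume "X \<inter> E = X"
    then show ?thesis
      using avoiding_chain_modular_join[OF join.hyps(1,2,3) _ _ join.prems] IH by blast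
  next
    assume "X \<inter> F = X"
    moreover have "modular_join M F E" "round_flat M (F \<inter> E)"
      using join.hyps(2,3) by (auto simp: modular_join_def Int_commute)
    ultimately show ?thesis
      using avoiding_chain_modular_join[OF join.hyps(1) _ _ _ _ join.prems, of F E] IH by blast
  qed
qed

section \<open>From avoiding chains to divisional flags\<close>

lemma modularly_extended_imp_simple: "modularly_extended M \<Longrightarrow> simple_matroid M"
  by (induction rule: modularly_extended.induct)

lemma modularly_extended_imp_divisional_flag:
  assumes ME: "modularly_extended M"
  shows "has_divisional_flag M"
proof -
  note simple = modularly_extended_imp_simple[OF ME]
  note M = simple_imp_matroid[OF simple]
  \<comment> \<open>The empty flat is round because it has no proper subset; a chain avoiding it has
    full length.\<close>
  have "round_flat M {}" "modular_flat M {}"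
    using flat_empty[OF simple] rk_empty[OF M] by (auto simp: round_flat_iff[OF M] modular_flat_iff[OF M])
  then obtain Y where Y: "avoiding_chain M {} (rk M (ground M)) Y"
    using modularly_extended_imp_avoiding_chain[OF ME] rk_empty[OF M] by fastforce
  then have "flat M (Y (rk M (ground M)))" "rk M (Y (rk M (ground M))) = rk M (ground M)"
    by (auto simp: avoiding_chain_def)
  \<comment> \<open>The chain records only ranks at its end; a flat of full rank is the ground
    set.\<close>
  then have "Y (rk M (ground M)) = ground M"
    using flat_ground[OF M] flat_subset by (intro flat_eqI[OF M]) auto
  with Y have "divisional_flag M Y"
    by (simp add: divisional_flag_def avoiding_chain_def Let_def)
  then show ?thesis by (auto simp: has_divisional_flag_def)
qed

theorem theorem1p8:
  "(\<forall>M :: 'a matroid. simple_matroid M \<and> modularly_extended M \<longrightarrow> has_divisional_flag M) \<and>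
   (\<forall>\<A> :: ('k::field ^ 'n) set set.
      central_arrangement \<A> \<and> modularly_extended (dependence_matroid \<A>) \<longrightarrow> divisionally_free \<A>)"
  by (auto simp: divisionally_free_def intro: modularly_extended_imp_divisional_flag)

end
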